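(* Let $d\ge 2$ and $0<\alpha<2$. For $t>0$ and $x\in\mathbb{R}^d$ let \[P_t^\alpha(x)=(2\pi)^{-d}\int_{\mathbb{R}^d} e^{-ix\cdot\xi}e^{-t|\xi|^\alpha}\,d\xi .\] Then for every $c$ with $(d-1)/2<c<d$, every $t>0$ and every $x\neq 0$, \[P_t^\alpha(x)=\frac{t^{-d/\alpha}}{\alpha\pi^{d/2}}\,\frac{1}{2\pi i}\int_{c-i\infty}^{c+i\infty}\frac{\Gamma(\frac{z}{\alpha})\,\Gamma(\frac{d-z}{2})\,2^{-z}}{\Gamma(\frac{z}{2})}\,\big(t^{-1/\alpha}|x|\big)^{-d+z}\,dz,\] and $P_t^\alpha(x)$ has the asymptotic expansion (as $t^{-1/\alpha}|x|\to\infty$) \[P_t^\alpha(x)\sim\frac{t^{-d/\alpha}}{\pi^{d/2}}\sum_{n=1}^{\infty}\big(1-1_{\mathbb{Z}}(n\alpha/2)\big)\frac{(-1)^n}{n!}\,\frac{\Gamma(\frac{d+n\alpha}{2})\,2^{n\alpha}}{\Gamma(-\frac{n\alpha}{2})}\,\big(t^{-1/\alpha}|x|\big)^{-d-n\alpha}.\]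
   Context: $\Gamma$ is the Euler gamma function (meromorphically continued to $\mathbb{C}$, with $1/\Gamma$ entire). $1_{\mathbb{Z}}$ denotes the indicator function of the integers. The integral $\int_{c-i\infty}^{c+i\infty}$ is along the vertical line $\Re z=c$. $P_t^\alpha$ is the transition density of the symmetric $\alpha$-stable process in $\mathbb{R}^d$. *)

theory Defs
  imports "HOL-Analysis.Analysis"
begin

definition stable_density :: "real \<Rightarrow> real \<Rightarrow> 'a::euclidean_space \<Rightarrow> complex" where
  "stable_density \<alpha> t x =
     complex_of_real ((2 * pi) powr (- real DIM('a))) *
     (LINT \<xi>|lborel. exp (- \<i> * complex_of_real (x \<bullet> \<xi>)) *
                     complex_of_real (exp (- t * norm \<xi> powr \<alpha>)))"

text \<open>Mellin--Barnes integrand, d = dimension, r = t^(-1/alpha) |x|.\<close>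
definition mb_integrand :: "nat \<Rightarrow> real \<Rightarrow> real \<Rightarrow> complex \<Rightarrow> complex" where
  "mb_integrand d \<alpha> r z =
     Gamma (z / complex_of_real \<alpha>) * Gamma ((of_nat d - z) / 2) * (2 powr (- z))
       / Gamma (z / 2) * (complex_of_real r powr (- of_nat d + z))"

definition asym_coeff :: "nat \<Rightarrow> real \<Rightarrow> nat \<Rightarrow> real" where
  "asym_coeff d \<alpha> n =
     (1 - indicator \<int> (real n * \<alpha> / 2)) * ((-1) ^ n / fact n) *
     (Gamma ((real d + real n * \<alpha>) / 2) * 2 powr (real n * \<alpha>) / Gamma (- (real n * \<alpha> / 2)))"

end

theory Submission
  imports Defs "HOL-Complex_Analysis.Complex_Analysis" "HOL-Probability.Probability" "HOL-Real_Asymp.Real_Asymp"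
begin

text \<open>
  The Mellin transform pair \<open>exp (- u) = 1/(2 \<pi> \<i>) \<integral> \<Gamma>(w) u powr (- w) dw\<close> with
  \<open>u = t |\<xi>| powr \<alpha>\<close>, combined with
  \<open>\<Gamma>(\<alpha>w/2) |\<xi>| powr (- \<alpha>w) = \<integral> s powr (\<alpha>w/2 - 1) exp (- s |\<xi>|\<^sup>2) ds\<close>, exhibits \<open>exp (- t |\<xi>| powr \<alpha>)\<close>
  as a mixture of Gaussians with weight \<open>m(s) = 1/(2 \<pi> \<i>) \<integral> \<Gamma>(w) t powr (- w) s powr (\<alpha>w/2 - 1) / \<Gamma>(\<alpha>w/2) dw\<close>.
  Since \<open>\<alpha> < 2\<close>, this integrand decays exponentially on every vertical strip, so the line of integration may
  be moved freely between the poles \<open>w = 0, -1, -2, \<dots>\<close> of \<open>\<Gamma>\<close>, the one at \<open>0\<close> being cancelled. Moving it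
  inside \<open>Re w > 0\<close> gives \<open>m(s) = O(s powr a)\<close> for every \<open>a > -1\<close>, which justifies taking the Fourier transform
  under the integral and yields the Mellin-Barnes formula. Moving it to the left expands \<open>m\<close> in powers of \<open>s\<close>
  with an error bound valid for all \<open>s > 0\<close>, and integrating this expansion term by term against the heat kernel
  gives the asymptotic series.
\<close>

section \<open>Vertical decay of the Gamma function\<close>

text \<open>The obstacle is that |\<xi>| powr (- z) is not absolutely integrable on the whole space
  for any z, so the Mellin formula for exp (- t |\<xi>| powr \<alpha>) cannot be Fourier transformed
  under the contour integral by Fubini. Gaussians are integrable with an explicit transform, and
  with them every exchange of integrals is an absolute one. The price is integrability of m(s)
  against s powr (- d/2), which up to a constant is the L1 norm of exp (- s |\<xi>|^2) in \<xi>;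
  this is why m is bounded with two different exponents. The condition \<alpha> < 2 enters through
  one comparison: \<Gamma>(w) decays like exp (- pi |Im w| / 2), 1/\<Gamma>(\<alpha>w/2) grows like
  exp (pi \<alpha> |Im w| / 4), and the net rate pi (2 - \<alpha>) / 4 must be positive. The
  indicator in the series has a simple origin: the residue at w = -n carries the factor 1/\<Gamma>(-
  n\<alpha>/2), which vanishes exactly when n\<alpha>/2 is an integer.\<close>

text \<open>In product form \<open>|\<Gamma>(a + iy)| / \<Gamma>(a) = \<Prod>k. (1 + y\<^sup>2 / (a + k)\<^sup>2) powr (-1/2)\<close>
  increases with \<open>a\<close>. Hence the behaviour on every vertical line is controlled by the lines
  \<open>Re z \<in> 1/2 + \<nat>\<close>, where the reflection formula gives the modulus exactly.\<close>

lemma norm_Gamma_ratio_mono: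
  assumes "0 < a" "a \<le> b"
  shows "norm (Gamma (Complex a y)) * Gamma b \<le> norm (Gamma (Complex b y)) * Gamma a"
proof -
  have series: "norm (Gamma_series (Complex a y) n) * Gamma_series b n
      \<le> norm (Gamma_series (Complex b y) n) * Gamma_series a n" for n
  proof -
    define P where "P s = (\<Prod>k=0..n. norm (Complex s y + of_nat k))" for s
    define Q where "Q s = (\<Prod>k=0..n. s + real k)" for s
    have P: "norm (pochhammer (Complex s y) (Suc n)) = P s" for s
      unfolding pochhammer_prod P_def prod_norm by (simp add: atLeastLessThanSuc_atLeastAtMost)
    have Q: "pochhammer s (Suc n) = Q s" for s
      unfolding pochhammer_prod Q_def by (simp add: atLeastLessThanSuc_atLeastAtMost)
    have E: "norm (exp (Complex s y * of_real (ln (real n)))) = exp (s * ln (real n))" for s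
      by simp
    have pos: "P s > 0" "Q s > 0" if "s > 0" for s
      using that unfolding P_def Q_def
      by (auto intro!: prod_pos simp: complex_eq_iff add_pos_nonneg)
    \<comment> \<open>Cleared of denominators, this says that (s + k) / |s + k + iy| increases with
      s. The powers of n need no comparison: both sides carry n powr a and n powr b once
      each.\<close>
    have fac: "norm (Complex b y + of_nat k) * (a + k) \<le> norm (Complex a y + of_nat k) * (b + k)" for k :: nat
    proof -
      define u v where "u = a + k" and "v = b + k"
      have uv: "0 < u" "u \<le> v" using assms by (auto simp: u_def v_def)
      have "u\<^sup>2 * y\<^sup>2 \<le> v\<^sup>2 * y\<^sup>2"
        using uv by (intro mult_right_mono power_mono) auto
      hence "(v\<^sup>2 + y\<^sup>2) * u\<^sup>2 \<le> (u\<^sup>2 + y\<^sup>2) * v\<^sup>2" by (simp add: algebra_simps)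
      hence "sqrt ((v\<^sup>2 + y\<^sup>2) * u\<^sup>2) \<le> sqrt ((u\<^sup>2 + y\<^sup>2) * v\<^sup>2)" by simp
      hence "sqrt (v\<^sup>2 + y\<^sup>2) * u \<le> sqrt (u\<^sup>2 + y\<^sup>2) * v"
        using uv by (simp add: real_sqrt_mult)
      thus ?thesis by (simp add: cmod_def u_def v_def)
    qed
    have PQ: "P b * Q a \<le> P a * Q b"
      unfolding P_def Q_def prod.distrib[symmetric]
      using assms fac by (intro prod_mono) auto
    have "norm (Gamma_series (Complex a y) n) * Gamma_series b n
        = (fact n)\<^sup>2 * exp (a * ln n) * exp (b * ln n) * (1 / (P a * Q b))"
      unfolding Gamma_series_def norm_divide norm_mult Suc_eq_plus1[symmetric] P Q E
      by (simp add: power2_eq_square)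
    also have "\<dots> \<le> (fact n)\<^sup>2 * exp (a * ln n) * exp (b * ln n) * (1 / (P b * Q a))"
      using PQ pos assms by (intro mult_left_mono divide_left_mono mult_pos_pos) auto
    also have "\<dots> = norm (Gamma_series (Complex b y) n) * Gamma_series a n"
      unfolding Gamma_series_def norm_divide norm_mult Suc_eq_plus1[symmetric] P Q E
      by (simp add: power2_eq_square)
    finally show ?thesis .
  qed
  show ?thesis
    by (rule LIMSEQ_le[of "\<lambda>n. norm (Gamma_series (Complex a y) n) * Gamma_series b n" _
          "\<lambda>n. norm (Gamma_series (Complex b y) n) * Gamma_series a n"])
       (use series in \<open>auto intro!: tendsto_intros\<close>)
qed

lemma norm_Gamma_one_half:
  "norm (Gamma (Complex (1/2) y)) = sqrt (pi / cosh (pi * y))"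
proof -
  have "1 - Complex (1/2) y = cnj (Complex (1/2) y)" by (simp add: complex_eq_iff)
  hence "Gamma (Complex (1/2) y) * cnj (Gamma (Complex (1/2) y)) = of_real pi / sin (of_real pi * Complex (1/2) y)"
    using Gamma_reflection_complex[of "Complex (1/2) y"] by (simp add: cnj_Gamma)
  also have "of_real pi * Complex (1/2) y = of_real (pi/2) + \<i> * of_real (pi * y)"
    by (simp add: complex_eq_iff)
  also have "sin (of_real (pi/2) + \<i> * of_real (pi * y)) = of_real (cosh (pi * y))"
    by (simp add: complex_eq_iff Re_sin Im_sin cosh_def)
  finally have "complex_of_real ((norm (Gamma (Complex (1/2) y)))\<^sup>2) = of_real (pi / cosh (pi * y))"
    by (simp add: complex_norm_square[symmetric])
  hence "(norm (Gamma (Complex (1/2) y)))\<^sup>2 = pi / cosh (pi * y)"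
    by (simp only: of_real_eq_iff)
  thus ?thesis by (metis norm_ge_zero real_sqrt_unique)
qed

lemma norm_pochhammer_le:
  fixes z :: complex
  shows "norm (pochhammer z n) \<le> (norm z + real n) ^ n"
proof -
  have "norm (pochhammer z n) = (\<Prod>k=0..<n. norm (z + of_nat k))"
    by (simp add: pochhammer_prod prod_norm)
  also have "\<dots> \<le> (\<Prod>k=0..<n. norm z + real n)"
  proof (intro prod_mono conjI)
    fix k assume "k \<in> {0..<n}"
    thus "norm (z + of_nat k) \<le> norm z + real n"
      using norm_triangle_ineq[of z "of_nat k"] by simp
  qed auto
  finally show ?thesis by simp
qed

text \<open>At distance 1 from the real axis no factor is smaller than 1, so dividing by the product
  in \<Gamma>(z) = \<Gamma>(z + n) / \<open>pochhammer z n\<close> costs nothing.\<close>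

lemma norm_pochhammer_ge_1:
  fixes z :: complex
  assumes "1 \<le> \<bar>Im z\<bar>"
  shows "1 \<le> norm (pochhammer z n)"
proof -
  have "(\<Prod>k=0..<n. (1::real)) \<le> (\<Prod>k=0..<n. norm (z + of_nat k))"
  proof (intro prod_mono conjI)
    fix k
    show "1 \<le> norm (z + of_nat k)"
      using assms abs_Im_le_cmod[of "z + of_nat k"] by simp
  qed auto
  thus ?thesis by (simp add: pochhammer_prod prod_norm)
qed

lemma norm_Gamma_one_half_le:
  "norm (Gamma (Complex (1/2) y)) \<le> sqrt (2 * pi) * exp (- (pi / 2 * \<bar>y\<bar>))"
proof -
  have "exp (pi * \<bar>y\<bar>) / 2 \<le> cosh (pi * y)"
    by (cases "y \<ge> 0") (auto simp: cosh_def)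
  hence "pi / cosh (pi * y) \<le> pi / (exp (pi * \<bar>y\<bar>) / 2)"
    by (intro divide_left_mono) (auto simp: cosh_real_pos)
  also have "\<dots> = (sqrt (2 * pi) * exp (- (pi / 2 * \<bar>y\<bar>)))\<^sup>2"
    by (simp add: power_mult_distrib exp_minus field_simps flip: exp_double)
  finally show ?thesis
    unfolding norm_Gamma_one_half by (intro real_le_lsqrt) auto
qed

lemma norm_Gamma_one_half_ge:
  "sqrt pi * exp (- (pi / 2 * \<bar>y\<bar>)) \<le> norm (Gamma (Complex (1/2) y))"
proof -
  have "exp (- (pi * \<bar>y\<bar>)) \<le> exp (pi * \<bar>y\<bar>)"
    by simp
  hence "cosh (pi * y) \<le> exp (pi * \<bar>y\<bar>)"
    by (cases "y \<ge> 0") (auto simp: cosh_def)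
  hence "pi / exp (pi * \<bar>y\<bar>) \<le> pi / cosh (pi * y)"
    by (intro divide_left_mono) (auto simp: cosh_real_pos)
  moreover have "pi / exp (pi * \<bar>y\<bar>) = (sqrt pi * exp (- (pi / 2 * \<bar>y\<bar>)))\<^sup>2"
    by (simp add: power_mult_distrib exp_minus field_simps flip: exp_double)
  ultimately show ?thesis
    unfolding norm_Gamma_one_half by (intro real_le_rsqrt) auto
qed

section \<open>Gamma and its reciprocal in vertical strips\<close>

lemma Gamma_real_bounds_on_interval:
  fixes m :: real
  obtains B where "B > 0" "\<And>a. 1 \<le> a \<Longrightarrow> a \<le> m \<Longrightarrow> Gamma a \<le> B" "\<And>a. 1 \<le> a \<Longrightarrow> a \<le> m \<Longrightarrow> 1 / Gamma a \<le> B"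
proof -
  have "continuous_on {1..m} Gamma"
    by (rule continuous_on_Gamma) (auto elim!: nonpos_Ints_cases')
  hence "compact (Gamma ` {1..m})" by (intro compact_continuous_image) auto
  from compact_imp_bounded[OF this] obtain B1 where B1: "\<forall>x\<in>Gamma ` {1..m}. norm x \<le> B1"
    unfolding bounded_iff by blast
  have "compact ((\<lambda>x::real. rGamma x) ` {1..m})" by (intro compact_continuous_image continuous_intros) auto
  from compact_imp_bounded[OF this] obtain B2 where B2: "\<forall>x\<in>rGamma ` {1..m}. norm x \<le> B2"
    unfolding bounded_iff by blast
  show ?thesis
  proof (rule that[of "max 1 (max B1 B2)"])
    fix a assume a: "1 \<le> a" "a \<le> m"
    show "Gamma a \<le> max 1 (max B1 B2)" using B1[rule_format, OF imageI, of a] a by (simp add: abs_le_iff)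
    show "1 / Gamma a \<le> max 1 (max B1 B2)" using B2[rule_format, OF imageI, of a] a by (simp add: rGamma_inverse_Gamma inverse_eq_divide abs_le_iff)
  qed auto
qed

text \<open>Three moves: translate z by m into the right half plane, pass by monotonicity to the
  line Re = b further right, and come back to Re = 1/2 by the functional equation, where the modulus
  is explicit. Only the last move costs anything in Im z, a polynomial factor.\<close>

lemma Gamma_strip_bound:
  obtains C n where "\<And>z. \<bar>Re z\<bar> \<le> A \<Longrightarrow> 1 \<le> \<bar>Im z\<bar> \<Longrightarrow>
    norm (Gamma z) \<le> C * (1 + \<bar>Im z\<bar>) ^ n * exp (- (pi / 2 * \<bar>Im z\<bar>))"
proof -
  \<comment> \<open>Large enough that Re z + m lies in [1, 2m] throughout the strip.\<close>
  define m where "m = nat \<lceil>\<bar>A\<bar>\<rceil> + 1"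
  have m: "A + 1 \<le> real m" "1 \<le> m" unfolding m_def by linarith+
  \<comment> \<open>To the right of that interval and at an integer distance from 1/2.\<close>
  define b where "b = 2 * real m + 1/2"
  obtain B where B: "B > 0" "\<And>a. 1 \<le> a \<Longrightarrow> a \<le> 2 * real m \<Longrightarrow> Gamma a \<le> B"
    using Gamma_real_bounds_on_interval by metis
  have Gb: "Gamma b > 0" by (simp add: b_def Gamma_real_pos)
  show ?thesis
  proof (rule that[of "B / Gamma b * ((2 * real m + 1) ^ (2 * m) * sqrt (2 * pi))" "2 * m"])
    fix z :: complex assume z: "\<bar>Re z\<bar> \<le> A" "1 \<le> \<bar>Im z\<bar>"
    define a y where "a = Re z + real m" and "y = Im z"
    have a: "1 \<le> a" "a \<le> 2 * real m" using z m unfolding a_def by linarith+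
    have zn: "z \<notin> \<int>\<^sub>\<le>\<^sub>0" using z by (auto elim!: nonpos_Ints_cases')
    have "Gamma (z + of_nat m) = pochhammer z m * Gamma z"
      using pochhammer_Gamma[OF zn, of m] zn by (simp add: Gamma_eq_zero_iff)
    hence "norm (Gamma (z + of_nat m)) = norm (pochhammer z m) * norm (Gamma z)"
      by (simp add: norm_mult)
    moreover have "1 * norm (Gamma z) \<le> norm (pochhammer z m) * norm (Gamma z)"
      using norm_pochhammer_ge_1[OF z(2)] by (intro mult_right_mono) auto
    moreover have "z + of_nat m = Complex a y" by (simp add: complex_eq_iff a_def y_def)
    ultimately have 1: "norm (Gamma z) \<le> norm (Gamma (Complex a y))" by simp
    have "norm (Gamma (Complex a y)) * Gamma b \<le> norm (Gamma (Complex b y)) * Gamma a"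
      using a by (intro norm_Gamma_ratio_mono) (auto simp: b_def)
    also have "\<dots> \<le> norm (Gamma (Complex b y)) * B"
      using a B by (intro mult_left_mono) auto
    finally have 2: "norm (Gamma (Complex a y)) \<le> B / Gamma b * norm (Gamma (Complex b y))"
      using Gb by (simp add: field_simps)
    have hn: "Complex (1/2) y \<notin> \<int>\<^sub>\<le>\<^sub>0" by (auto elim!: nonpos_Ints_cases' simp: complex_eq_iff)
    have eq: "Complex (1/2) y + of_nat (2 * m) = Complex b y"
      by (simp add: complex_eq_iff b_def)
    have "Gamma (Complex b y) = pochhammer (Complex (1/2) y) (2 * m) * Gamma (Complex (1/2) y)"
      using pochhammer_Gamma[OF hn, of "2*m"] hn unfolding eq by (simp add: Gamma_eq_zero_iff)
    hence "norm (Gamma (Complex b y)) = norm (pochhammer (Complex (1/2) y) (2 * m)) * norm (Gamma (Complex (1/2) y))"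
      by (simp add: norm_mult)
    also have "\<dots> \<le> ((2 * real m + 1) * (1 + \<bar>y\<bar>)) ^ (2 * m) * (sqrt (2 * pi) * exp (- (pi / 2 * \<bar>y\<bar>)))"
    proof (intro mult_mono norm_Gamma_one_half_le)
      have "norm (Complex (1/2) y) \<le> 1/2 + \<bar>y\<bar>"
        using cmod_le[of "Complex (1/2) y"] by simp
      also have "1/2 + \<bar>y\<bar> + real (2 * m) \<le> (2 * real m + 1) * (1 + \<bar>y\<bar>)"
        by (simp add: algebra_simps)
      finally (add_right_mono[THEN order_trans]) have "norm (Complex (1/2) y) + real (2*m) \<le> (2 * real m + 1) * (1 + \<bar>y\<bar>)"
        by this
      thus "norm (pochhammer (Complex (1/2) y) (2 * m)) \<le> ((2 * real m + 1) * (1 + \<bar>y\<bar>)) ^ (2 * m)"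
        using norm_pochhammer_le[of "Complex (1/2) y" "2*m"]
        by (meson add_nonneg_nonneg norm_ge_zero of_nat_0_le_iff order_trans power_mono)
    qed auto
    finally have 3: "norm (Gamma (Complex b y)) \<le> \<dots>" .
    have "norm (Gamma z) \<le> B / Gamma b * (((2 * real m + 1) * (1 + \<bar>y\<bar>)) ^ (2 * m) * (sqrt (2 * pi) * exp (- (pi / 2 * \<bar>y\<bar>))))"
      using order_trans[OF 1 order_trans[OF 2 mult_left_mono[OF 3]]] B Gb by simp
    thus "norm (Gamma z) \<le> B / Gamma b * ((2 * real m + 1) ^ (2 * m) * sqrt (2 * pi)) * (1 + \<bar>Im z\<bar>) ^ (2 * m) * exp (- (pi / 2 * \<bar>Im z\<bar>))"
      by (simp only: power_mult_distrib y_def mult.assoc mult.commute mult.left_commute)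
  qed
qed

text \<open>A lower bound for |\<Gamma>| is needed here, so the monotonicity is used in the other
  direction, with 1/2 to the left of the translated line. Since \<open>rGamma\<close> is entire, the
  translation multiplies by the Pochhammer product instead of dividing by it, and points near the
  real axis are covered as well.\<close>

lemma rGamma_strip_bound:
  obtains C n where "\<And>z. \<bar>Re z\<bar> \<le> A \<Longrightarrow>
    norm (rGamma z) \<le> C * (1 + \<bar>Im z\<bar>) ^ n * exp (pi / 2 * \<bar>Im z\<bar>)"
proof -
  define m where "m = nat \<lceil>\<bar>A\<bar>\<rceil> + 1"
  have m: "\<bar>A\<bar> + 1 \<le> real m" "1 \<le> m" unfolding m_def by linarith+
  obtain B where B: "B > 0" "\<And>a. 1 \<le> a \<Longrightarrow> a \<le> 2 * real m \<Longrightarrow> 1 / Gamma a \<le> B"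
    using Gamma_real_bounds_on_interval by metis
  show ?thesis
  proof (rule that[of "(2 * real m) ^ m * B" "m"])
    fix z :: complex assume z: "\<bar>Re z\<bar> \<le> A"
    define a y where "a = Re z + real m" and "y = Im z"
    have a: "1 \<le> a" "a \<le> 2 * real m" using z m unfolding a_def by linarith+
    have eq: "z + of_nat m = Complex a y" by (simp add: complex_eq_iff a_def y_def)
    have "norm (rGamma z) = norm (pochhammer z m) * norm (rGamma (Complex a y))"
      using pochhammer_rGamma[of z m] by (simp add: norm_mult eq)
    also have "\<dots> \<le> (2 * real m * (1 + \<bar>y\<bar>)) ^ m * (B * exp (pi / 2 * \<bar>y\<bar>))"
    proof (intro mult_mono)
      have "norm z \<le> \<bar>A\<bar> + \<bar>y\<bar>"
        using cmod_le[of z] z by (simp add: y_def)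
      moreover have "1 * \<bar>y\<bar> \<le> (2 * real m) * \<bar>y\<bar>"
        using m by (intro mult_right_mono) auto
      ultimately have "norm z + real m \<le> 2 * real m * (1 + \<bar>y\<bar>)"
        using m by (simp add: algebra_simps)
      thus "norm (pochhammer z m) \<le> (2 * real m * (1 + \<bar>y\<bar>)) ^ m"
        using norm_pochhammer_le[of z m]
        by (meson add_nonneg_nonneg norm_ge_zero of_nat_0_le_iff order_trans power_mono)
      have Ga: "Gamma a > 0" using a by (simp add: Gamma_real_pos)
      have "norm (Gamma (Complex (1/2) y)) * Gamma a \<le> norm (Gamma (Complex a y)) * Gamma (1/2)"
        using a by (intro norm_Gamma_ratio_mono) auto
      moreover have "sqrt pi * exp (- (pi / 2 * \<bar>y\<bar>)) * Gamma a \<le> norm (Gamma (Complex (1/2) y)) * Gamma a"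
        using Ga by (intro mult_right_mono norm_Gamma_one_half_ge) auto
      ultimately have "sqrt pi * exp (- (pi / 2 * \<bar>y\<bar>)) * Gamma a \<le> norm (Gamma (Complex a y)) * sqrt pi"
        unfolding Gamma_one_half_real by linarith
      hence "sqrt pi * (exp (- (pi / 2 * \<bar>y\<bar>)) * Gamma a) \<le> sqrt pi * norm (Gamma (Complex a y))"
        by (simp only: mult_ac)
      hence "exp (- (pi / 2 * \<bar>y\<bar>)) * Gamma a \<le> norm (Gamma (Complex a y))"
        by simp
      hence "inverse (norm (Gamma (Complex a y))) \<le> inverse (exp (- (pi / 2 * \<bar>y\<bar>)) * Gamma a)"
        using Ga by (intro le_imp_inverse_le) auto
      also have "\<dots> = 1 / Gamma a * exp (pi / 2 * \<bar>y\<bar>)"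
        by (simp add: exp_minus field_simps)
      also have "\<dots> \<le> B * exp (pi / 2 * \<bar>y\<bar>)"
        using B a by (intro mult_right_mono) auto
      finally show "norm (rGamma (Complex a y)) \<le> B * exp (pi / 2 * \<bar>y\<bar>)"
        by (simp add: rGamma_inverse_Gamma norm_inverse)
    qed auto
    finally show "norm (rGamma z) \<le> (2 * real m) ^ m * B * (1 + \<bar>Im z\<bar>) ^ m * exp (pi / 2 * \<bar>Im z\<bar>)"
      by (simp only: power_mult_distrib y_def mult.assoc mult.commute mult.left_commute)
  qed
qed

lemma power_times_exp_bound:
  fixes \<kappa> \<kappa>' :: real
  assumes "\<kappa>' < \<kappa>"
  obtains C where "C > 0" "\<And>y. 0 \<le> y \<Longrightarrow> (1 + y) ^ n * exp (- (\<kappa> * y)) \<le> C * exp (- (\<kappa>' * y))"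
proof -
  \<comment> \<open>At most 1, so that \<delta> (1 + y) \<le> 1 + \<delta> y \<le> exp (\<delta> y);
    and small enough that the n-th power of this costs no more than the allowed loss \<kappa> -
    \<kappa>' in the rate. The 1 added to n covers n = 0.\<close>
  define \<delta> where "\<delta> = min 1 ((\<kappa> - \<kappa>') / (real n + 1))"
  have \<delta>: "0 < \<delta>" "\<delta> \<le> 1" using assms by (auto simp: \<delta>_def)
  have "\<delta> * real n \<le> (\<kappa> - \<kappa>') / (real n + 1) * real n"
    by (intro mult_right_mono) (auto simp: \<delta>_def)
  also have "\<dots> \<le> \<kappa> - \<kappa>'"
    using assms by (simp add: field_simps)
  finally have n\<delta>: "\<delta> * real n \<le> \<kappa> - \<kappa>'" .
  show ?thesis
  proof (rule that[of "(1 / \<delta>) ^ n"])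
    fix y :: real assume y: "0 \<le> y"
    have "\<delta> * (1 + y) \<le> 1 + \<delta> * y" using \<delta> by (simp add: algebra_simps)
    also have "\<dots> \<le> exp (\<delta> * y)" by (rule exp_ge_add_one_self)
    finally have "1 + y \<le> 1 / \<delta> * exp (\<delta> * y)" using \<delta> by (simp add: field_simps)
    hence "(1 + y) ^ n \<le> (1 / \<delta> * exp (\<delta> * y)) ^ n" using y by (intro power_mono) auto
    also have "\<dots> = (1 / \<delta>) ^ n * exp (\<delta> * real n * y)"
      by (simp add: power_mult_distrib power_divide exp_of_nat_mult[symmetric] mult_ac)
    finally have "(1 + y) ^ n * exp (- (\<kappa> * y)) \<le> (1 / \<delta>) ^ n * exp (\<delta> * real n * y) * exp (- (\<kappa> * y))"
      by (intro mult_right_mono) auto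
    also have "\<dots> = (1 / \<delta>) ^ n * exp (\<delta> * real n * y - \<kappa> * y)"
      by (simp add: exp_diff exp_minus field_simps)
    also have "\<delta> * real n * y - \<kappa> * y \<le> - (\<kappa>' * y)"
      using mult_right_mono[OF n\<delta> y] by (simp add: algebra_simps)
    finally show "(1 + y) ^ n * exp (- (\<kappa> * y)) \<le> (1 / \<delta>) ^ n * exp (- (\<kappa>' * y))"
      using \<delta> by (simp add: mult_left_mono)
  qed (use \<delta> in auto)
qed

lemma Gamma_exponential_decay:
  assumes "\<kappa> < pi / 2"
  obtains C where "\<And>z. \<bar>Re z\<bar> \<le> A \<Longrightarrow> 1 \<le> \<bar>Im z\<bar> \<Longrightarrow> norm (Gamma z) \<le> C * exp (- (\<kappa> * \<bar>Im z\<bar>))"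
proof -
  obtain C n where C: "\<And>z. \<bar>Re z\<bar> \<le> A \<Longrightarrow> 1 \<le> \<bar>Im z\<bar> \<Longrightarrow>
    norm (Gamma z) \<le> C * (1 + \<bar>Im z\<bar>) ^ n * exp (- (pi / 2 * \<bar>Im z\<bar>))"
    using Gamma_strip_bound by metis
  obtain D where D: "\<And>y. 0 \<le> y \<Longrightarrow> (1 + y) ^ n * exp (- (pi / 2 * y)) \<le> D * exp (- (\<kappa> * y))"
    using power_times_exp_bound[OF assms] by metis
  show ?thesis
  proof (rule that[of "\<bar>C\<bar> * D"])
    fix z assume z: "\<bar>Re z\<bar> \<le> A" "1 \<le> \<bar>Im z\<bar>"
    have "norm (Gamma z) \<le> \<bar>C\<bar> * ((1 + \<bar>Im z\<bar>) ^ n * exp (- (pi / 2 * \<bar>Im z\<bar>)))"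
      unfolding mult.assoc[symmetric]
      by (rule order_trans[OF C[OF z]], intro mult_right_mono) auto
    also have "\<dots> \<le> \<bar>C\<bar> * (D * exp (- (\<kappa> * \<bar>Im z\<bar>)))"
      by (intro mult_left_mono D) auto
    finally show "norm (Gamma z) \<le> \<bar>C\<bar> * D * exp (- (\<kappa> * \<bar>Im z\<bar>))" by (simp add: mult.assoc)
  qed
qed

text \<open>The rates pi/2 of \<Gamma> and - pi \<alpha> / 4 of the reciprocal add up to pi (2 -
  \<alpha>) / 4; staying strictly below this value absorbs both polynomial factors.\<close>

lemma Gamma_rGamma_exponential_decay:
  assumes "0 < \<alpha>" and \<kappa>: "\<kappa> < pi * (2 - \<alpha>) / 4"
  obtains C where "\<And>z. \<bar>Re z\<bar> \<le> A \<Longrightarrow> 1 \<le> \<bar>Im z\<bar> \<Longrightarrow>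
     norm (Gamma z * rGamma (of_real (\<alpha> / 2) * z)) \<le> C * exp (- (\<kappa> * \<bar>Im z\<bar>))"
proof -
  obtain C n where C: "\<And>z. \<bar>Re z\<bar> \<le> A \<Longrightarrow> 1 \<le> \<bar>Im z\<bar> \<Longrightarrow>
    norm (Gamma z) \<le> C * (1 + \<bar>Im z\<bar>) ^ n * exp (- (pi / 2 * \<bar>Im z\<bar>))"
    using Gamma_strip_bound by metis
  obtain C' n' where C': "\<And>z. \<bar>Re z\<bar> \<le> \<alpha> / 2 * A \<Longrightarrow>
    norm (rGamma z) \<le> C' * (1 + \<bar>Im z\<bar>) ^ n' * exp (pi / 2 * \<bar>Im z\<bar>)"
    using rGamma_strip_bound by metis
  obtain D where D: "\<And>y. 0 \<le> y \<Longrightarrow> (1 + y) ^ (n + n') * exp (- (pi * (2 - \<alpha>) / 4 * y)) \<le> D * exp (- (\<kappa> * y))"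
    using power_times_exp_bound[OF \<kappa>] by metis
  show ?thesis
  proof (rule that[of "\<bar>C\<bar> * (\<bar>C'\<bar> * (1 + \<alpha>) ^ n') * D"])
    fix z assume z: "\<bar>Re z\<bar> \<le> A" "1 \<le> \<bar>Im z\<bar>"
    have 1: "norm (Gamma z) \<le> \<bar>C\<bar> * ((1 + \<bar>Im z\<bar>) ^ n * exp (- (pi / 2 * \<bar>Im z\<bar>)))"
      unfolding mult.assoc[symmetric]
      by (rule order_trans[OF C[OF z]], intro mult_right_mono) auto
    have im: "Im (of_real (\<alpha> / 2) * z) = \<alpha> / 2 * Im z" "Re (of_real (\<alpha> / 2) * z) = \<alpha> / 2 * Re z" by auto
    have "norm (rGamma (of_real (\<alpha> / 2) * z)) \<le> C' * (1 + \<bar>\<alpha> / 2 * Im z\<bar>) ^ n' * exp (pi / 2 * \<bar>\<alpha> / 2 * Im z\<bar>)"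
      using z assms(1) by (intro C'[of "of_real (\<alpha> / 2) * z", unfolded im]) (auto simp: abs_mult)
    also have "\<dots> \<le> \<bar>C'\<bar> * ((1 + \<alpha>) * (1 + \<bar>Im z\<bar>)) ^ n' * exp (pi / 2 * \<bar>\<alpha> / 2 * Im z\<bar>)"
    proof (intro mult_mono power_mono)
      have "\<alpha> / 2 * \<bar>Im z\<bar> \<le> \<alpha> * \<bar>Im z\<bar>"
        using assms(1) by (intro mult_right_mono) auto
      thus "1 + \<bar>\<alpha> / 2 * Im z\<bar> \<le> (1 + \<alpha>) * (1 + \<bar>Im z\<bar>)"
        using assms(1) by (simp add: algebra_simps abs_mult)
    qed (use assms in auto)
    also have "pi / 2 * \<bar>\<alpha> / 2 * Im z\<bar> = pi * \<alpha> / 4 * \<bar>Im z\<bar>" using assms(1) by (simp add: abs_mult)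
    finally have 2: "norm (rGamma (of_real (\<alpha> / 2) * z)) \<le> \<bar>C'\<bar> * ((1 + \<alpha>) * (1 + \<bar>Im z\<bar>)) ^ n' * exp (pi * \<alpha> / 4 * \<bar>Im z\<bar>)" .
    have "norm (Gamma z * rGamma (of_real (\<alpha> / 2) * z)) \<le>
       (\<bar>C\<bar> * ((1 + \<bar>Im z\<bar>) ^ n * exp (- (pi / 2 * \<bar>Im z\<bar>)))) * (\<bar>C'\<bar> * ((1 + \<alpha>) * (1 + \<bar>Im z\<bar>)) ^ n' * exp (pi * \<alpha> / 4 * \<bar>Im z\<bar>))"
      unfolding norm_mult by (intro mult_mono 1 2) auto
    also have "\<dots> = \<bar>C\<bar> * (\<bar>C'\<bar> * (1 + \<alpha>) ^ n') * ((1 + \<bar>Im z\<bar>) ^ (n + n') * (exp (- (pi / 2 * \<bar>Im z\<bar>)) * exp (pi * \<alpha> / 4 * \<bar>Im z\<bar>)))"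
      by (simp add: power_add power_mult_distrib mult_ac)
    also have "exp (- (pi / 2 * \<bar>Im z\<bar>)) * exp (pi * \<alpha> / 4 * \<bar>Im z\<bar>) = exp (- (pi * (2 - \<alpha>) / 4 * \<bar>Im z\<bar>))"
      unfolding exp_add[symmetric] by (rule arg_cong[where f = exp]) (simp add: field_simps)
    also have "\<bar>C\<bar> * (\<bar>C'\<bar> * (1 + \<alpha>) ^ n') * ((1 + \<bar>Im z\<bar>) ^ (n + n') * exp (- (pi * (2 - \<alpha>) / 4 * \<bar>Im z\<bar>)))
        \<le> \<bar>C\<bar> * (\<bar>C'\<bar> * (1 + \<alpha>) ^ n') * (D * exp (- (\<kappa> * \<bar>Im z\<bar>)))"
      using assms by (intro mult_left_mono D) auto
    finally show "norm (Gamma z * rGamma (of_real (\<alpha> / 2) * z)) \<le> \<bar>C\<bar> * (\<bar>C'\<bar> * (1 + \<alpha>) ^ n') * D * exp (- (\<kappa> * \<bar>Im z\<bar>))"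
      by (simp add: mult.assoc)
  qed
qed

section \<open>Shifting the line of integration\<close>

lemma integrable_exp_minus_abs:
  fixes \<kappa> :: real
  assumes "0 < \<kappa>"
  shows "integrable lborel (\<lambda>y. exp (- (\<kappa> * \<bar>y\<bar>)))"
proof -
  define h where "h = (\<lambda>y::real. indicator {0..} y * exp (- (\<kappa> * y)))"
  have "(\<lambda>y. exp (- \<kappa> * y)) absolutely_integrable_on {0..}"
    using assms by (intro nonnegative_absolutely_integrable_1 integrable_on_exp_minus_to_infinity) auto
  hence "integrable lebesgue h" by (simp add: set_integrable_def h_def)
  hence h: "integrable lborel h"
    by (subst (asm) integrable_completion) (auto simp: h_def)
  have h': "integrable lborel (\<lambda>y. h (- y))"
    using lborel_integrable_real_affine[OF h, of "-1" 0] by simp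
  show ?thesis
    by (rule Bochner_Integration.integrable_bound[OF Bochner_Integration.integrable_add[OF h h']])
       (auto simp: h_def indicator_def)
qed

lemma integrable_exponential_decay:
  fixes g :: "real \<Rightarrow> complex"
  assumes cont: "continuous_on UNIV g" and "0 < \<kappa>"
    and decay: "\<And>y. 1 \<le> \<bar>y\<bar> \<Longrightarrow> norm (g y) \<le> C * exp (- (\<kappa> * \<bar>y\<bar>))"
  shows "integrable lborel g"
proof -
  have "compact (g ` {-1..1})"
    by (intro compact_continuous_image continuous_on_subset[OF cont]) auto
  from compact_imp_bounded[OF this] obtain B where B: "\<forall>z\<in>g ` {-1..1}. norm z \<le> B"
    unfolding bounded_iff by blast
  have B0: "0 \<le> B" using order_trans[OF norm_ge_zero B[rule_format, OF imageI, of 0]] by simp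
  have bound: "norm (g y) \<le> (\<bar>C\<bar> + B * exp \<kappa>) * exp (- (\<kappa> * \<bar>y\<bar>))" for y
  proof (cases "1 \<le> \<bar>y\<bar>")
    case True
    have "norm (g y) \<le> C * exp (- (\<kappa> * \<bar>y\<bar>))" by (rule decay[OF True])
    also have "\<dots> \<le> (\<bar>C\<bar> + B * exp \<kappa>) * exp (- (\<kappa> * \<bar>y\<bar>))"
      using B0 by (intro mult_right_mono) (auto intro: add_increasing2)
    finally show ?thesis .
  next
    case False
    have "y \<in> {-1..1}" using False by auto
    hence "norm (g y) \<le> B * 1" using B by auto
    also have "\<dots> \<le> B * exp (\<kappa> * (1 - \<bar>y\<bar>))"
      using False B0 assms(2) by (intro mult_left_mono) auto
    also have "\<dots> = (B * exp \<kappa>) * exp (- (\<kappa> * \<bar>y\<bar>))"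
      by (simp add: algebra_simps flip: exp_add)
    also have "\<dots> \<le> (\<bar>C\<bar> + B * exp \<kappa>) * exp (- (\<kappa> * \<bar>y\<bar>))"
      by (intro mult_right_mono) auto
    finally show ?thesis .
  qed
  have int: "integrable lborel (\<lambda>y. (\<bar>C\<bar> + B * exp \<kappa>) * exp (- (\<kappa> * \<bar>y\<bar>)))"
    using integrable_exp_minus_abs[OF assms(2)] by simp
  show ?thesis
  proof (rule Bochner_Integration.integrable_bound[OF int])
    show "g \<in> borel_measurable lborel"
      using borel_measurable_continuous_onI[OF cont] by simp
  qed (use bound in \<open>auto intro: order_trans[OF _ abs_ge_self]\<close>)
qed

lemma truncated_integral_tendsto:
  fixes g :: "real \<Rightarrow> complex"
  assumes g: "integrable lborel g"
  shows "(\<lambda>k. integral {-real k..real k} g) \<longlonglongrightarrow> (LINT y|lborel. g y)"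
proof -
  have eq: "integral {-real k..real k} g = (LINT y|lborel. indicator {-real k..real k} y *\<^sub>R g y)" for k
    using g by (subst set_borel_integral_eq_integral(2)[symmetric])
      (auto simp: set_integrable_def set_lebesgue_integral_def intro: integrable_mult_indicator)
  show ?thesis unfolding eq
  proof (rule integral_dominated_convergence[where w = "\<lambda>y. norm (g y)"])
    show "AE x in lborel. (\<lambda>k. indicat_real {- real k..real k} x *\<^sub>R g x) \<longlonglongrightarrow> g x"
    proof (rule AE_I2, rule tendsto_eventually)
      fix x :: real
      have "eventually (\<lambda>k. \<bar>x\<bar> \<le> real k) sequentially"
        using eventually_ge_at_top[of "nat \<lceil>\<bar>x\<bar>\<rceil>"] by eventually_elim linarith
      thus "eventually (\<lambda>k. indicat_real {- real k..real k} x *\<^sub>R g x = g x) sequentially"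
        by eventually_elim (auto simp: indicator_def)
    qed
  qed (use g in \<open>auto simp: indicator_def\<close>)
qed

lemma of_real_pos_notin_nonpos_Ints: "0 < c \<Longrightarrow> complex_of_real c \<notin> \<int>\<^sub>\<le>\<^sub>0"
  by (auto elim!: nonpos_Ints_cases' simp: complex_eq_iff)

lemma negative_half_integer_notin_nonpos_Ints:
  assumes b: "b = - real N - 1/2"
  shows "Complex b y \<notin> \<int>\<^sub>\<le>\<^sub>0"
proof
  assume "Complex b y \<in> \<int>\<^sub>\<le>\<^sub>0"
  then obtain n where "b = - real n" by (auto elim!: nonpos_Ints_cases' simp: complex_eq_iff)
  with b have "real (2 * N + 1) = real (2 * n)" by simp
  hence "2 * N + 1 = 2 * n" by (simp only: of_nat_eq_iff)
  thus False by presburger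
qed

section \<open>Residue calculus for Gamma times an entire function\<close>

context
  fixes H :: "complex \<Rightarrow> complex" and \<kappa> :: real
  assumes holo: "H holomorphic_on UNIV" and \<kappa>: "0 < \<kappa>"
    and decay: "\<And>A. \<exists>C. \<forall>z. \<bar>Re z\<bar> \<le> A \<longrightarrow> 1 \<le> \<bar>Im z\<bar> \<longrightarrow> norm (Gamma z * H z) \<le> C * exp (- (\<kappa> * \<bar>Im z\<bar>))"
begin

lemma continuous_on_Gamma_times: "S \<inter> \<int>\<^sub>\<le>\<^sub>0 = {} \<Longrightarrow> continuous_on S (\<lambda>z. Gamma z * H z)"
  by (intro continuous_intros holomorphic_on_imp_continuous_on holomorphic_on_subset[OF holo]) auto

lemma integrable_Gamma_vertical:
  assumes c: "complex_of_real c \<notin> \<int>\<^sub>\<le>\<^sub>0"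
  shows "integrable lborel (\<lambda>y. Gamma (Complex c y) * H (Complex c y))"
proof -
  obtain C where C: "\<And>z. \<bar>Re z\<bar> \<le> \<bar>c\<bar> \<Longrightarrow> 1 \<le> \<bar>Im z\<bar> \<Longrightarrow> norm (Gamma z * H z) \<le> C * exp (- (\<kappa> * \<bar>Im z\<bar>))"
    using decay by metis
  have "range (Complex c) \<inter> \<int>\<^sub>\<le>\<^sub>0 = {}"
    using c by (auto elim!: nonpos_Ints_cases' simp: complex_eq_iff) 
  from continuous_on_Gamma_times[OF this]
  have "continuous_on UNIV ((\<lambda>z. Gamma z * H z) \<circ> Complex c)"
    by (intro continuous_on_compose) (auto simp: Complex_eq intro!: continuous_intros)
  thus ?thesis
    by (intro integrable_exponential_decay[OF _ \<kappa>, of _ C]) (use C[of "Complex c _"] in \<open>auto simp: o_def\<close>)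
qed

text \<open>As H is entire, the only singularities inside the rectangle are the simple poles of
  \<Gamma> at 0, ..., -N, with residues (-1)^n / n!. The left edge sits half way between -N and -N -
  1.\<close>

lemma Gamma_rectangle_integral:
  assumes c: "0 < c" and b: "b = - real N - 1/2" and T: "0 < T"
  shows "contour_integral (rectpath (Complex b (-T)) (Complex c T)) (\<lambda>z. Gamma z * H z)
    = 2 * pi * \<i> * (\<Sum>n\<le>N. (-1)^n / fact n * H (- of_nat n))"
proof -
  \<comment> \<open>The half plane stops at the next pole -N - 1, which it excludes, so finitely
    many poles remain.\<close>
  define S where "S = {z. - real N - 1 < Re z}"
  define pts where "pts = (\<lambda>n. - complex_of_nat n) ` {..N}"
  define \<gamma> where "\<gamma> = rectpath (Complex b (-T)) (Complex c T)"
  have S: "open S" "connected S"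
    unfolding S_def using open_halfspace_Re_gt convex_halfspace_Re_gt convex_connected by blast+
  have nonpos: "\<int>\<^sub>\<le>\<^sub>0 \<inter> S \<subseteq> pts"
    by (auto elim!: nonpos_Ints_cases' simp: S_def pts_def)
  have inj: "inj_on (\<lambda>n. - complex_of_nat n) {..N}"
    by (auto simp: inj_on_def)
  have "contour_integral \<gamma> (\<lambda>z. Gamma z * H z) =
      2 * pi * \<i> * (\<Sum>p\<in>pts. winding_number \<gamma> p * residue (\<lambda>z. Gamma z * H z) p)"
  proof (rule Residue_theorem[OF S])
    show "(\<lambda>z. Gamma z * H z) holomorphic_on S - pts"
      using nonpos by (intro holomorphic_intros holomorphic_on_subset[OF holo]) auto
    show "path_image \<gamma> \<subseteq> S - pts"
      unfolding \<gamma>_def using c b T by (subst path_image_rectpath) (auto simp: S_def pts_def)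
    show "\<forall>z. z \<notin> S \<longrightarrow> winding_number \<gamma> z = 0"
      unfolding \<gamma>_def using c b T
      by (auto intro!: winding_number_rectpath_outside simp: S_def in_cbox_complex_iff)
  qed (auto simp: \<gamma>_def pts_def)
  also have "(\<Sum>p\<in>pts. winding_number \<gamma> p * residue (\<lambda>z. Gamma z * H z) p) =
     (\<Sum>n\<le>N. winding_number \<gamma> (- of_nat n) * residue (\<lambda>z. Gamma z * H z) (- of_nat n))"
    unfolding pts_def by (simp add: sum.reindex[OF inj])
  also have "\<dots> = (\<Sum>n\<le>N. (-1)^n / fact n * H (- of_nat n))"
  proof (rule sum.cong[OF refl])
    fix n assume n: "n \<in> {..N}"
    have w: "winding_number \<gamma> (- of_nat n) = 1"
      unfolding \<gamma>_def using n c b T by (intro winding_number_rectpath) (auto simp: in_box_complex_iff)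
    \<comment> \<open>The residue is computed on the plane with all other poles deleted, an open set
      on which -n is the only singularity.\<close>
    have "residue (\<lambda>z. Gamma z * H z) (- of_nat n) = (-1)^n / fact n * H (- of_nat n)"
    proof (rule residue_simple'[of "- (\<int>\<^sub>\<le>\<^sub>0 - {- of_nat n})"])
      show "(\<lambda>z. Gamma z * H z) holomorphic_on - (\<int>\<^sub>\<le>\<^sub>0 - {- of_nat n}) - {- of_nat n}"
        by (intro holomorphic_intros holomorphic_on_subset[OF holo]) auto
      have "isCont H (- of_nat n)"
        using holo holomorphic_on_imp_continuous_on continuous_on_eq_continuous_at open_UNIV by blast
      hence "((\<lambda>z. (Gamma z * (z + of_nat n)) * H z) \<longlongrightarrow> (-1)^n / fact n * H (- of_nat n)) (at (- of_nat n))"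
        by (intro tendsto_mult Gamma_residues) (auto simp: isCont_def)
      thus "((\<lambda>z. Gamma z * H z * (z - - of_nat n)) \<longlongrightarrow> (-1)^n / fact n * H (- of_nat n)) (at (- of_nat n))"
        by (simp add: mult_ac)
      show "open (- (\<int>\<^sub>\<le>\<^sub>0 - {- complex_of_nat n}))"
        by (intro open_Compl closed_subset_Ints) (auto elim!: nonpos_Ints_cases)
    qed auto
    with w show "winding_number \<gamma> (- of_nat n) * residue (\<lambda>z. Gamma z * H z) (- of_nat n) = (-1)^n / fact n * H (- of_nat n)"
      by simp
  qed
  finally show ?thesis by (simp add: \<gamma>_def)
qed

text \<open>The horizontal edges at heights k and -k have fixed length and an integrand of size exp
  (- \<kappa> k), so they disappear as k grows. The factor \<i> of dz = \<i> dy cancels against the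
  one in 2 pi \<i>.\<close>

lemma Gamma_contour_shift:
  assumes c: "0 < c" and b: "b = - real N - 1/2"
  shows "(LINT y|lborel. Gamma (Complex c y) * H (Complex c y)) =
    2 * pi * (\<Sum>n\<le>N. (-1)^n / fact n * H (- of_nat n)) + (LINT y|lborel. Gamma (Complex b y) * H (Complex b y))"
proof -
  define f where "f = (\<lambda>z. Gamma z * H z)"
  define A where "A = max c \<bar>b\<bar>"
  obtain C where C: "\<And>z. \<bar>Re z\<bar> \<le> A \<Longrightarrow> 1 \<le> \<bar>Im z\<bar> \<Longrightarrow> norm (f z) \<le> C * exp (- (\<kappa> * \<bar>Im z\<bar>))"
    using decay unfolding f_def by metis
  have cn: "complex_of_real c \<notin> \<int>\<^sub>\<le>\<^sub>0"
    by (rule of_real_pos_notin_nonpos_Ints[OF c])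
  have bn: "complex_of_real b \<notin> \<int>\<^sub>\<le>\<^sub>0"
    using negative_half_integer_notin_nonpos_Ints[OF b, of 0] by (simp add: complex_of_real_def)
  define R where "R = 2 * pi * \<i> * (\<Sum>n\<le>N. (-1)^n / fact n * H (- of_nat n))"
  \<comment> \<open>The defect of the identity at height k; by the residue theorem it is minus the
    contribution of the two horizontal edges.\<close>
  define E where "E k = \<i> * integral {-real k..real k} (\<lambda>y. f (Complex c y)) - \<i> * integral {-real k..real k} (\<lambda>y. f (Complex b y)) - R" for k
  have E: "norm (E k) \<le> 2 * (c - b) * \<bar>C\<bar> * exp (- \<kappa> * real k)" if k: "1 \<le> k" for k
  proof -
    define T where "T = real k"
    have T: "1 \<le> T" using k by (simp add: T_def)
    have bc: "b < c" using c b by simp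
    let ?a1 = "Complex b (-T)" and ?a2 = "Complex c (-T)" and ?a3 = "Complex c T" and ?a4 = "Complex b T"
    have avoid: "closed_segment u v \<inter> \<int>\<^sub>\<le>\<^sub>0 = {}"
      if "Im u = Im v \<and> Im u \<noteq> 0 \<or> Re u = Re v \<and> complex_of_real (Re u) \<notin> \<int>\<^sub>\<le>\<^sub>0" for u v
      using that by (auto simp: closed_segment_same_Re closed_segment_same_Im elim!: nonpos_Ints_cases')
        (metis minus_of_nat_in_nonpos_Ints of_real_minus of_real_of_nat_eq)
    have cint: "f contour_integrable_on linepath u v"
      if "Im u = Im v \<and> Im u \<noteq> 0 \<or> Re u = Re v \<and> complex_of_real (Re u) \<notin> \<int>\<^sub>\<le>\<^sub>0" for u v
      unfolding f_def using avoid[OF that]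
      by (intro contour_integrable_continuous_linepath continuous_on_Gamma_times)
    have i12: "f contour_integrable_on linepath ?a1 ?a2" using T by (intro cint) auto
    have i23: "f contour_integrable_on linepath ?a2 ?a3" using cn by (intro cint) auto
    have i34: "f contour_integrable_on linepath ?a3 ?a4" using T by (intro cint) auto
    have i41: "f contour_integrable_on linepath ?a4 ?a1" using bn by (intro cint) auto
    have "R = contour_integral (linepath ?a1 ?a2) f + contour_integral (linepath ?a2 ?a3) f
       + contour_integral (linepath ?a3 ?a4) f + contour_integral (linepath ?a4 ?a1) f"
      using Gamma_rectangle_integral[OF c b, of T, symmetric] T i12 i23 i34 i41
      by (simp add: R_def f_def[symmetric] rectpath_def Let_def contour_integrable_joinI add.assoc)
    also have "contour_integral (linepath ?a4 ?a1) f = - contour_integral (linepath ?a1 ?a4) f"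
      using i41 contour_integral_reverse_linepath[of ?a1 ?a4 f] T bn
      by (metis add.inverse_inverse contour_integral_reversepath reversepath_linepath valid_path_linepath)
    also have "contour_integral (linepath ?a1 ?a4) f = \<i> * integral {-T..T} (\<lambda>y. f (Complex b y))"
      using T by (intro contour_integral_linepath_same_Re) auto
    also have "contour_integral (linepath ?a2 ?a3) f = \<i> * integral {-T..T} (\<lambda>y. f (Complex c y))"
      using T by (intro contour_integral_linepath_same_Re) auto
    finally have "E k = - contour_integral (linepath ?a1 ?a2) f - contour_integral (linepath ?a3 ?a4) f"
      by (simp add: E_def T_def)
    also have "norm \<dots> \<le> norm (contour_integral (linepath ?a1 ?a2) f) + norm (contour_integral (linepath ?a3 ?a4) f)"
      by (metis norm_minus_cancel norm_triangle_ineq4)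
    also have "\<dots> \<le> \<bar>C\<bar> * exp (- \<kappa> * T) * (c - b) + \<bar>C\<bar> * exp (- \<kappa> * T) * (c - b)"
    proof (intro add_mono)
      have est: "norm (f z) \<le> \<bar>C\<bar> * exp (- \<kappa> * T)" if "b \<le> Re z" "Re z \<le> c" "\<bar>Im z\<bar> = T" for z
      proof -
        have "\<bar>Re z\<bar> \<le> A" using that by (auto simp: A_def)
        from C[OF this] have "norm (f z) \<le> C * exp (- \<kappa> * T)" using that T by simp
        also have "\<dots> \<le> \<bar>C\<bar> * exp (- \<kappa> * T)" by (intro mult_right_mono) auto
        finally show ?thesis .
      qed
      have n: "norm (?a2 - ?a1) = c - b" "norm (?a4 - ?a3) = c - b"
        using bc by (auto simp: cmod_def)
      show "norm (contour_integral (linepath ?a1 ?a2) f) \<le> \<bar>C\<bar> * exp (- \<kappa> * T) * (c - b)"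
        unfolding n[symmetric] using bc T
        by (intro contour_integral_bound_linepath i12 est) (auto simp: closed_segment_same_Im closed_segment_eq_real_ivl)
      show "norm (contour_integral (linepath ?a3 ?a4) f) \<le> \<bar>C\<bar> * exp (- \<kappa> * T) * (c - b)"
        unfolding n(2)[symmetric] using bc T
        by (intro contour_integral_bound_linepath i34 est) (auto simp: closed_segment_same_Im closed_segment_eq_real_ivl)
    qed
    finally show ?thesis by (simp add: T_def algebra_simps)
  qed
  have "(\<lambda>k. exp (- \<kappa> * real k)) \<longlonglongrightarrow> 0"
    using \<kappa> by real_asymp
  hence "(\<lambda>k. 2 * (c - b) * \<bar>C\<bar> * exp (- \<kappa> * real k)) \<longlonglongrightarrow> 0"
    by (intro tendsto_mult_right_zero)
  hence "E \<longlonglongrightarrow> 0"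
    by (rule Lim_null_comparison[rotated]) (rule eventually_mono[OF eventually_ge_at_top[of 1] E])
  moreover have "E \<longlonglongrightarrow> \<i> * (LINT y|lborel. f (Complex c y)) - \<i> * (LINT y|lborel. f (Complex b y)) - R"
    unfolding E_def f_def
    by (intro tendsto_intros truncated_integral_tendsto integrable_Gamma_vertical cn bn)
  ultimately have "\<i> * (LINT y|lborel. f (Complex c y)) - \<i> * (LINT y|lborel. f (Complex b y)) - R = 0"
    using LIMSEQ_unique by blast
  hence "\<i> * ((LINT y|lborel. f (Complex c y)) - ((LINT y|lborel. f (Complex b y)) + 2 * pi * (\<Sum>n\<le>N. (-1)^n / fact n * H (- of_nat n)))) = 0"
    by (simp add: R_def algebra_simps)
  hence "(LINT y|lborel. f (Complex c y)) = (LINT y|lborel. f (Complex b y)) + 2 * pi * (\<Sum>n\<le>N. (-1)^n / fact n * H (- of_nat n))"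
    by (simp only: mult_eq_0_iff complex_i_not_zero simp_thms right_minus_eq)
  thus ?thesis by (simp add: f_def)
qed

end

section \<open>Mellin and Fourier transforms\<close>

text \<open>The factors are the distances from -N - 1/2 to the poles -k of \<Gamma>. Dropping to k +
  1 - 1/2 \<ge> k for all but the smallest, which is 1/2, leaves N! / 2.\<close>

lemma prod_half_shift_ge: "fact N / 2 \<le> (\<Prod>k=0..N. real (N - k) + 1 / 2)"
proof (induction N)
  case (Suc N)
  have "fact (Suc N) / 2 \<le> (real (Suc N) + 1/2) * (fact N / 2 :: real)"
    by (simp add: field_simps)
  also have "\<dots> \<le> (real (Suc N) + 1/2) * (\<Prod>k=0..N. real (N - k) + 1 / 2)"
    by (intro mult_left_mono Suc.IH) auto
  also have "\<dots> = (\<Prod>k=0..Suc N. real (Suc N - k) + 1 / 2)"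
    by (subst prod.atLeast0_atMost_Suc_shift) simp
  finally show ?case .
qed simp

text \<open>Climbing N + 1 steps to Re = 1/2 divides by a Pochhammer product that is smallest on the
  real axis. The resulting 1/N! outweighs the geometric growth of exp (q z) when the line moves
  infinitely far to the left.\<close>

lemma norm_Gamma_negative_half_le:
  assumes b: "b = - real N - 1/2"
  shows "norm (Gamma (Complex b y)) \<le> 2 / fact N * norm (Gamma (Complex (1/2) y))"
proof -
  note bn = negative_half_integer_notin_nonpos_Ints[OF b, of y]
  have "fact N / 2 \<le> (\<Prod>k=0..N. real (N - k) + 1 / 2)"
    by (rule prod_half_shift_ge)
  also have "\<dots> \<le> (\<Prod>k=0..N. norm (Complex b y + of_nat k))"
  proof (intro prod_mono conjI)
    fix k assume "k \<in> {0..N}"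
    thus "real (N - k) + 1 / 2 \<le> norm (Complex b y + of_nat k)"
      using abs_Re_le_cmod[of "Complex b y + of_nat k"] by (simp add: b of_nat_diff)
  qed auto
  also have "\<dots> = norm (pochhammer (Complex b y) (Suc N))"
    unfolding pochhammer_Suc_prod prod_norm ..
  finally have "fact N / 2 * norm (Gamma (Complex b y)) \<le> norm (pochhammer (Complex b y) (Suc N)) * norm (Gamma (Complex b y))"
    by (intro mult_right_mono) auto
  also have "\<dots> = norm (Gamma (Complex b y + of_nat (Suc N)))"
    using pochhammer_Gamma[OF bn, of "Suc N"] bn
    by (simp add: Gamma_eq_zero_iff norm_divide del: of_nat_Suc)
  also have "Complex b y + of_nat (Suc N) = Complex (1/2) y"
    by (simp add: complex_eq_iff b)
  finally show ?thesis by (simp add: field_simps)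
qed

lemma Gamma_times_exp_decay:
  fixes q :: real
  shows "\<exists>C. \<forall>z. \<bar>Re z\<bar> \<le> A \<longrightarrow> 1 \<le> \<bar>Im z\<bar> \<longrightarrow> norm (Gamma z * exp (of_real q * z)) \<le> C * exp (- (1 * \<bar>Im z\<bar>))"
proof -
  \<comment> \<open>Any positive rate below pi/2 would serve; 1 keeps the constants simple.\<close>
  have "1 < pi / 2" using pi_gt3 by simp
  then obtain C where C: "\<And>z. \<bar>Re z\<bar> \<le> A \<Longrightarrow> 1 \<le> \<bar>Im z\<bar> \<Longrightarrow> norm (Gamma z) \<le> C * exp (- (1 * \<bar>Im z\<bar>))"
    using Gamma_exponential_decay by metis
  show ?thesis
  proof (intro exI allI impI)
    fix z :: complex assume z: "\<bar>Re z\<bar> \<le> A" "1 \<le> \<bar>Im z\<bar>"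
    have "q * Re z \<le> \<bar>q\<bar> * A"
      by (rule order_trans[OF abs_ge_self]) (use z(1) in \<open>auto simp: abs_mult intro: mult_left_mono\<close>)
    hence "norm (Gamma z * exp (of_real q * z)) \<le> (C * exp (- (1 * \<bar>Im z\<bar>))) * exp (\<bar>q\<bar> * A)"
      unfolding norm_mult using order_trans[OF norm_ge_zero C[OF z]] by (intro mult_mono C z) auto
    thus "norm (Gamma z * exp (of_real q * z)) \<le> (C * exp (\<bar>q\<bar> * A)) * exp (- (1 * \<bar>Im z\<bar>))"
      by (simp add: mult_ac)
  qed
qed

text \<open>Put u = exp (- q), so that exp (q z) = u powr (- z). Moving the line to Re z = -N - 1/2
  collects the first N + 1 terms of the exponential series of exp (- u), and the integral left over
  tends to 0 with N.\<close>

lemma Cahen_Mellin: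
  fixes q :: real
  assumes c: "0 < c"
  shows "integrable lborel (\<lambda>y. Gamma (Complex c y) * exp (of_real q * Complex c y))"
    and "(LINT y|lborel. Gamma (Complex c y) * exp (of_real q * Complex c y)) = 2 * pi * exp (- exp (- q))"
proof -
  define H where "H = (\<lambda>z::complex. exp (of_real q * z))"
  have H: "H holomorphic_on UNIV" unfolding H_def by (intro holomorphic_intros)
  have decay: "\<exists>C. \<forall>z. \<bar>Re z\<bar> \<le> A \<longrightarrow> 1 \<le> \<bar>Im z\<bar> \<longrightarrow> norm (Gamma z * H z) \<le> C * exp (- (1 * \<bar>Im z\<bar>))" for A
    unfolding H_def by (rule Gamma_times_exp_decay)
  note pos = of_real_pos_notin_nonpos_Ints
  show "integrable lborel (\<lambda>y. Gamma (Complex c y) * exp (of_real q * Complex c y))"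
    using integrable_Gamma_vertical[OF H zero_less_one decay pos[OF c]] by (simp add: H_def)
  define M where "M = (LINT y|lborel. norm (Gamma (Complex (1/2) y)))"
  have intM: "integrable lborel (\<lambda>y. norm (Gamma (Complex (1/2) y)))"
  proof -
    have "\<exists>C. \<forall>z. \<bar>Re z\<bar> \<le> A \<longrightarrow> 1 \<le> \<bar>Im z\<bar> \<longrightarrow> norm (Gamma z * 1) \<le> C * exp (- (1 * \<bar>Im z\<bar>))" for A
      using Gamma_times_exp_decay[of A 0] by simp
    from integrable_Gamma_vertical[OF holomorphic_on_const zero_less_one this pos[of "1/2"]]
    show ?thesis by simp
  qed
  let ?I = "LINT y|lborel. Gamma (Complex c y) * H (Complex c y)"
  define S where "S N = 2 * pi * (\<Sum>n\<le>N. (-1)^n / fact n * H (- of_nat n))" for N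
  \<comment> \<open>In terms of u the remainder is of order u powr (N + 1/2) / N!.\<close>
  have bound: "norm (S N - ?I) \<le> 2 * M * exp (- q / 2) * (exp (- q) ^ N / fact N)" for N
  proof -
    define b where "b = - real N - 1/2"
    have "S N - ?I = - (LINT y|lborel. Gamma (Complex b y) * H (Complex b y))"
      using Gamma_contour_shift[OF H zero_less_one decay c b_def] by (simp add: S_def)
    also have "norm \<dots> \<le> (LINT y|lborel. norm (Gamma (Complex b y) * H (Complex b y)))"
      by simp
    also have "\<dots> \<le> (LINT y|lborel. (2 / fact N * exp (q * b)) * norm (Gamma (Complex (1/2) y)))"
    proof (rule integral_mono')
      show "integrable lborel (\<lambda>y. (2 / fact N * exp (q * b)) * norm (Gamma (Complex (1/2) y)))"
        using intM by simp
      fix y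
      have "norm (Gamma (Complex b y) * H (Complex b y)) = exp (q * b) * norm (Gamma (Complex b y))"
        by (simp add: H_def norm_mult)
      also have "\<dots> \<le> exp (q * b) * (2 / fact N * norm (Gamma (Complex (1/2) y)))"
        by (intro mult_left_mono norm_Gamma_negative_half_le b_def) auto
      finally show "norm (Gamma (Complex b y) * H (Complex b y)) \<le> (2 / fact N * exp (q * b)) * norm (Gamma (Complex (1/2) y))"
        by (simp add: mult_ac)
    qed auto
    also have "\<dots> = 2 / fact N * exp (q * b) * M" using intM by (simp add: M_def)
    also have "q * b = - q / 2 + real N * (- q)" by (simp add: b_def algebra_simps)
    also have "exp \<dots> = exp (- q / 2) * exp (- q) ^ N"
      by (simp only: exp_add exp_of_nat_mult)
    finally show ?thesis by (simp add: mult_ac)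
  qed
  have "(\<lambda>N. exp (- q) ^ N / fact N) \<longlonglongrightarrow> 0"
    using summable_LIMSEQ_zero[OF summable_exp[of "exp (- q)"]] by (simp add: field_simps)
  hence "(\<lambda>N. 2 * M * exp (- q / 2) * (exp (- q) ^ N / fact N)) \<longlonglongrightarrow> 0"
    by (rule tendsto_mult_right_zero)
  hence "(\<lambda>N. S N - ?I) \<longlonglongrightarrow> 0"
    by (rule Lim_null_comparison[rotated]) (use bound in auto)
  hence 1: "S \<longlonglongrightarrow> ?I" by (simp add: LIM_zero_iff)
  have Seq: "S N = 2 * pi * (\<Sum>n\<le>N. (- complex_of_real (exp (- q))) ^ n /\<^sub>R fact n)" for N
  proof -
    have "H (- of_nat n) = of_real (exp (- q)) ^ n" for n
      by (simp add: H_def flip: exp_of_nat_mult of_real_power exp_of_real) (simp add: mult_ac)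
    thus ?thesis unfolding S_def
      by (intro arg_cong2[where f = "(*)"] sum.cong refl) (simp add: scaleR_conv_of_real field_simps power_minus[of "complex_of_real _"])
  qed
  have "S \<longlonglongrightarrow> 2 * pi * exp (- complex_of_real (exp (- q)))"
    unfolding Seq using exp_converges[of "- complex_of_real (exp (- q))"]
    by (intro tendsto_mult tendsto_const) (simp add: sums_def_le)
  from LIMSEQ_unique[OF 1 this]
  show "(LINT y|lborel. Gamma (Complex c y) * exp (of_real q * Complex c y)) = 2 * pi * exp (- exp (- q))"
    by (simp add: H_def exp_of_real[symmetric])
qed

section \<open>Euler's integral in the logarithmic variable\<close>

lemma integrable_mult_right_cancel:
  fixes c :: "'a::{real_normed_field,second_countable_topology}"
  assumes "integrable M (\<lambda>x. c * f x)" "c \<noteq> 0"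
  shows "integrable M f"
  using integrable_mult_right[OF assms(1), of "inverse c"] assms(2) by (simp add: mult.assoc[symmetric])

text \<open>Euler's integral of s powr (z - 1) exp (- \<rho> s) under s = exp v. The factor \<rho>
  becomes the translation of v by ln \<rho>, which needs no change of variables beyond the affine
  one.\<close>

lemma Gamma_exp_integral:
  fixes \<rho> :: real
  assumes z: "Re z > 0" and \<rho>: "\<rho> > 0"
  shows "integrable lborel (\<lambda>v. exp (z * of_real v) * of_real (exp (- \<rho> * exp v)))"
    and "(LINT v|lborel. exp (z * of_real v) * of_real (exp (- \<rho> * exp v))) = Gamma z * exp (- z * of_real (ln \<rho>))"
proof -
  define g where "g = (\<lambda>v. exp (z * of_real v) * complex_of_real (exp (- exp v)))"
  let ?f = "\<lambda>t. complex_of_real t powr (z - 1) / of_real (exp t)"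
  have rng: "range exp = {0::real<..}"
    by (auto simp: image_iff) (metis exp_ln)
  have "?f absolutely_integrable_on exp ` UNIV \<and> integral (exp ` UNIV) ?f = Gamma z"
    using absolutely_integrable_Gamma_integral'[OF z] Gamma_integral_complex'[OF z]
    by (simp add: rng integral_unique)
  hence "(\<lambda>x. \<bar>exp x\<bar> *\<^sub>R ?f (exp x)) absolutely_integrable_on UNIV \<and> integral UNIV (\<lambda>x. \<bar>exp x\<bar> *\<^sub>R ?f (exp x)) = Gamma z"
    by (subst has_absolute_integral_change_of_variables_real) (auto intro!: derivative_eq_intros simp: inj_on_def)
  moreover have "\<bar>exp x\<bar> *\<^sub>R ?f (exp x) = g x" for x
  proof -
    have "complex_of_real (exp x) powr (z - 1) = exp ((z - 1) * of_real x)"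
      by (simp add: powr_def Ln_of_real)
    thus ?thesis
      by (simp add: g_def scaleR_conv_of_real exp_minus field_simps exp_diff flip: exp_of_real)
  qed
  ultimately have ai: "g absolutely_integrable_on UNIV" and int: "integral UNIV g = Gamma z"
    by simp_all
  have gm: "g \<in> borel_measurable borel" unfolding g_def by measurable
  have g: "integrable lborel g"
    using ai gm by (simp add: set_integrable_def integrable_completion)
  have g': "(LINT v|lborel. g v) = Gamma z"
    using set_borel_integral_eq_integral(2)[of UNIV g] g int by (simp add: set_integrable_def set_lebesgue_integral_def)
  have sh: "g (ln \<rho> + 1 * v) = exp (z * of_real (ln \<rho>)) * (exp (z * of_real v) * of_real (exp (- \<rho> * exp v)))" for v
    using \<rho> by (simp add: g_def exp_add distrib_left)
  have "integrable lborel (\<lambda>v. g (ln \<rho> + 1 * v))"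
    by (rule lborel_integrable_real_affine[OF g]) simp
  thus "integrable lborel (\<lambda>v. exp (z * of_real v) * of_real (exp (- \<rho> * exp v)))"
    unfolding sh by (rule integrable_mult_right_cancel) simp
  have "Gamma z = (LINT v|lborel. g (ln \<rho> + 1 * v))"
    using lborel_integral_real_affine[of 1 g "ln \<rho>"] g' by simp
  also have "\<dots> = exp (z * of_real (ln \<rho>)) * (LINT v|lborel. exp (z * of_real v) * of_real (exp (- \<rho> * exp v)))"
    unfolding sh by simp
  finally show "(LINT v|lborel. exp (z * of_real v) * of_real (exp (- \<rho> * exp v))) = Gamma z * exp (- z * of_real (ln \<rho>))"
    by (simp add: exp_minus field_simps)
qed

text \<open>The substitution v to - v, that is s to 1/s: this is the form met in the heat kernel,
  whose exponent is - |x|^2 / (4 s).\<close>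

lemma Gamma_exp_integral_reflected:
  fixes \<rho> :: real
  assumes z: "Re z > 0" and \<rho>: "\<rho> > 0"
  shows "integrable lborel (\<lambda>v. exp (- z * of_real v) * of_real (exp (- \<rho> * exp (- v))))"
    and "(LINT v|lborel. exp (- z * of_real v) * of_real (exp (- \<rho> * exp (- v)))) = Gamma z * exp (- z * of_real (ln \<rho>))"
  using lborel_integrable_real_affine[OF Gamma_exp_integral(1)[OF assms], of "-1" 0]
    lborel_integral_real_affine[of "-1" "\<lambda>v. exp (z * of_real v) * complex_of_real (exp (- \<rho> * exp v))" 0]
    Gamma_exp_integral(2)[OF assms]
  by simp_all

section \<open>Fourier transform of the Gaussian\<close>

lemma gaussian_fourier_real:
  fixes a s :: real
  assumes s: "s > 0"
  shows "integrable lborel (\<lambda>u. exp (- \<i> * of_real (a * u)) * of_real (exp (- s * u\<^sup>2)))"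
    and "(LINT u|lborel. exp (- \<i> * of_real (a * u)) * of_real (exp (- s * u\<^sup>2))) = of_real (sqrt (pi / s) * exp (- a\<^sup>2 / (4 * s)))"
proof -
  \<comment> \<open>Chosen so that the substitution of sqrt (2 s) u for the normal variable turns
    its characteristic function at t into the transform of exp (- s u^2) at a.\<close>
  define t where "t = - a / sqrt (2 * s)"
  define g where "g = (\<lambda>x. std_normal_density x *\<^sub>R iexp (t * x))"
  have "integrable lborel std_normal_density" using integrable_std_normal_moment[of 0] by simp
  hence g: "integrable lborel g"
    by (rule Bochner_Integration.integrable_bound) (auto simp: g_def)
  have "char std_normal_distribution t = (LINT x|lborel. g x)"
    unfolding char_def g_def by (subst integral_density) auto
  hence gi: "(LINT x|lborel. g x) = of_real (exp (- t\<^sup>2 / 2))"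
    by (simp add: char_std_normal_distribution)
  have sh: "g (0 + sqrt (2 * s) * u) = of_real (1 / sqrt (2 * pi)) * (exp (- \<i> * of_real (a * u)) * of_real (exp (- s * u\<^sup>2)))" for u
  proof -
    have "t * (0 + sqrt (2 * s) * u) = - (a * u)" using s by (simp add: t_def)
    hence "iexp (t * (0 + sqrt (2 * s) * u)) = exp (- \<i> * of_real (a * u))" by (simp only: of_real_minus mult_minus_left mult_minus_right)
    moreover have "std_normal_density (0 + sqrt (2 * s) * u) = 1 / sqrt (2 * pi) * exp (- s * u\<^sup>2)"
      using s by (simp add: std_normal_density_def power_mult_distrib)
    ultimately show ?thesis
      unfolding g_def by (simp add: scaleR_conv_of_real mult_ac)
  qed
  have "sqrt (2 * s) \<noteq> 0" using s by simp
  from lborel_integrable_real_affine[OF g this, of 0]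
  show "integrable lborel (\<lambda>u. exp (- \<i> * of_real (a * u)) * of_real (exp (- s * u\<^sup>2)))"
    unfolding sh by (rule integrable_mult_right_cancel) simp
  define J where "J = (LINT u|lborel. exp (- \<i> * of_real (a * u)) * complex_of_real (exp (- s * u\<^sup>2)))"
  have "of_real (exp (- t\<^sup>2 / 2)) = \<bar>sqrt (2 * s)\<bar> *\<^sub>R (of_real (1 / sqrt (2 * pi)) * J)"
    unfolding J_def gi[symmetric] lborel_integral_real_affine[OF \<open>sqrt (2 * s) \<noteq> 0\<close>, of g 0] sh
    by (subst integral_mult_right_zero) simp
  also have "\<dots> = of_real (sqrt (2 * s) / sqrt (2 * pi)) * J"
    using s by (simp add: scaleR_conv_of_real)
  finally have "of_real (sqrt (2 * pi) / sqrt (2 * s)) * complex_of_real (exp (- t\<^sup>2 / 2)) =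
      of_real (sqrt (2 * pi) / sqrt (2 * s)) * (of_real (sqrt (2 * s) / sqrt (2 * pi)) * J)" by simp
  also have "\<dots> = of_real (sqrt (2 * pi) / sqrt (2 * s) * (sqrt (2 * s) / sqrt (2 * pi))) * J"
    by (simp only: of_real_mult mult.assoc)
  also have "sqrt (2 * pi) / sqrt (2 * s) * (sqrt (2 * s) / sqrt (2 * pi)) = 1"
    using s by simp
  finally have "J = of_real (sqrt (2 * pi) / sqrt (2 * s) * exp (- t\<^sup>2 / 2))" by simp
  also have "sqrt (2 * pi) / sqrt (2 * s) = sqrt (pi / s)" by (simp add: real_sqrt_mult real_sqrt_divide)
  also have "- t\<^sup>2 / 2 = - a\<^sup>2 / (4 * s)" using s by (simp add: t_def power_divide)
  finally show "(LINT u|lborel. exp (- \<i> * of_real (a * u)) * of_real (exp (- s * u\<^sup>2))) = of_real (sqrt (pi / s) * exp (- a\<^sup>2 / (4 * s)))"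
    by (simp add: J_def)
qed

text \<open>Both the character and the Gaussian factor over the coordinates of an orthonormal basis,
  and Lebesgue measure is the image of the product measure, so the one-dimensional result is
  multiplied DIM times.\<close>

lemma gaussian_fourier:
  fixes x :: "'a::euclidean_space" and s :: real
  assumes s: "s > 0"
  shows "integrable lborel (\<lambda>\<xi>. exp (- \<i> * of_real (x \<bullet> \<xi>)) * of_real (exp (- s * (norm \<xi>)\<^sup>2)))"
    and "(LINT \<xi>|lborel. exp (- \<i> * of_real (x \<bullet> \<xi>)) * of_real (exp (- s * (norm \<xi>)\<^sup>2)))
      = of_real ((pi / s) powr (real DIM('a) / 2) * exp (- (norm x)\<^sup>2 / (4 * s)))"
proof -
  interpret product_sigma_finite "\<lambda>_::'a. lborel :: real measure" ..
  define F where "F = (\<lambda>\<xi>::'a. exp (- \<i> * of_real (x \<bullet> \<xi>)) * complex_of_real (exp (- s * (norm \<xi>)\<^sup>2)))"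
  define f where "f = (\<lambda>b u. exp (- \<i> * of_real ((x \<bullet> b) * u)) * complex_of_real (exp (- s * u\<^sup>2)))"
  have Fm: "F \<in> borel_measurable borel" unfolding F_def by measurable
  have eq: "F (\<Sum>b\<in>Basis. h b *\<^sub>R b) = (\<Prod>b\<in>Basis. f b (h b))" for h
  proof -
    let ?\<xi> = "\<Sum>b\<in>Basis. h b *\<^sub>R b"
    have 1: "x \<bullet> ?\<xi> = (\<Sum>b\<in>Basis. (x \<bullet> b) * h b)"
      by (simp add: inner_sum_right mult.commute)
    have 2: "(norm ?\<xi>)\<^sup>2 = (\<Sum>b\<in>Basis. (h b)\<^sup>2)"
      unfolding power2_norm_eq_inner euclidean_inner[of ?\<xi> ?\<xi>] by (simp add: power2_eq_square)
    show ?thesis unfolding F_def f_def 1 2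
      by (simp add: prod.distrib exp_sum sum_distrib_left flip: of_real_prod)
  qed
  have int: "integrable lborel (f b)" for b
    unfolding f_def using gaussian_fourier_real(1)[OF s, of "x \<bullet> b"] by simp
  have meas: "(\<lambda>h. \<Sum>b\<in>Basis. h b *\<^sub>R b) \<in> (\<Pi>\<^sub>M b\<in>Basis. lborel) \<rightarrow>\<^sub>M (borel :: 'a measure)"
    by measurable
  have "integrable (\<Pi>\<^sub>M b\<in>(Basis::'a set). lborel) (\<lambda>h. F (\<Sum>b\<in>Basis. h b *\<^sub>R b))"
    unfolding eq by (intro product_integrable_prod int) auto
  thus "integrable lborel (\<lambda>\<xi>. exp (- \<i> * of_real (x \<bullet> \<xi>)) * of_real (exp (- s * (norm \<xi>)\<^sup>2)))"
    unfolding F_def[symmetric] by (subst lborel_eq, subst integrable_distr_eq[OF meas Fm])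
  have "(LINT \<xi>|lborel. F \<xi>) = (LINT h|(\<Pi>\<^sub>M b\<in>(Basis::'a set). lborel). F (\<Sum>b\<in>Basis. h b *\<^sub>R b))"
    by (subst lborel_eq, subst integral_distr[OF meas Fm]) simp
  also have "\<dots> = (\<Prod>b\<in>Basis. (LINT u|lborel. f b u))"
    unfolding eq by (intro product_integral_prod int) auto
  also have "\<dots> = (\<Prod>b\<in>(Basis::'a set). of_real (sqrt (pi / s) * exp (- (x \<bullet> b)\<^sup>2 / (4 * s))))"
    unfolding f_def by (intro prod.cong refl gaussian_fourier_real(2)[OF s])
  also have "\<dots> = of_real (sqrt (pi / s) ^ DIM('a) * (\<Prod>b\<in>(Basis::'a set). exp (- (x \<bullet> b)\<^sup>2 / (4 * s))))"
    by (simp add: prod.distrib)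
  also have "(\<Prod>b\<in>(Basis::'a set). exp (- (x \<bullet> b)\<^sup>2 / (4 * s))) = exp (- (norm x)\<^sup>2 / (4 * s))"
    unfolding power2_norm_eq_inner euclidean_inner[of x x]
    by (subst exp_sum[symmetric]) (auto simp: power2_eq_square sum_negf simp flip: sum_divide_distrib)
  also have "sqrt (pi / s) ^ DIM('a) = (pi / s) powr (real DIM('a) / 2)"
    using s by (simp add: powr_half_sqrt[symmetric] powr_powr flip: powr_realpow)
  finally show "(LINT \<xi>|lborel. exp (- \<i> * of_real (x \<bullet> \<xi>)) * of_real (exp (- s * (norm \<xi>)\<^sup>2)))
      = of_real ((pi / s) powr (real DIM('a) / 2) * exp (- (norm x)\<^sup>2 / (4 * s)))"
    by (simp only: F_def)
qed

section \<open>The stable subordinator\<close>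

text \<open>The density at \<open>s = exp v\<close> of the \<open>\<alpha>/2\<close>-stable subordinator at time \<open>t\<close> is
  \<open>subordinator_kernel \<alpha> (\<alpha> * v / 2 - ln t) / s\<close>: in the logarithmic variable \<open>v\<close> both the scaling in
  \<open>t\<close> and the inversion \<open>s \<mapsto> 1/s\<close> become affine substitutions on the real line.\<close>

definition subordinator_kernel :: "real \<Rightarrow> real \<Rightarrow> complex" where
  "subordinator_kernel \<alpha> q = 1 / (2 * pi) *
     (LINT y|lborel. Gamma (Complex 1 y) * (rGamma (of_real (\<alpha> / 2) * Complex 1 y) * exp (of_real q * Complex 1 y)))"

lemma measurable_Complex [measurable]: "Complex c \<in> borel_measurable borel"
  by (intro borel_measurable_continuous_onI) (auto simp: Complex_eq intro!: continuous_intros)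

lemma measurable_Gamma_vertical:
  assumes c: "0 < c"
  shows "(\<lambda>y. Gamma (Complex c y)) \<in> borel_measurable borel"
proof -
  have "continuous_on (range (Complex c)) Gamma"
    using c by (intro continuous_on_Gamma) (auto elim!: nonpos_Ints_cases' simp: complex_eq_iff)
  hence "continuous_on UNIV (Gamma \<circ> Complex c)"
    by (intro continuous_on_compose) (auto simp: Complex_eq intro!: continuous_intros)
  thus ?thesis by (intro borel_measurable_continuous_onI) (simp add: o_def)
qed

lemma measurable_rGamma [measurable]: "(rGamma :: complex \<Rightarrow> complex) \<in> borel_measurable borel"
  by (intro borel_measurable_continuous_onI continuous_intros)

context
  fixes \<alpha> :: real
  assumes \<alpha>: "0 < \<alpha>" "\<alpha> < 2"
begin

lemma kernel_holomorphic: "(\<lambda>z. rGamma (of_real (\<alpha> / 2) * z) * exp (of_real q * z)) holomorphic_on UNIV"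
  by (intro holomorphic_intros)

lemma kernel_decay:
  "\<exists>C. \<forall>z. \<bar>Re z\<bar> \<le> A \<longrightarrow> 1 \<le> \<bar>Im z\<bar> \<longrightarrow>
     norm (Gamma z * (rGamma (of_real (\<alpha> / 2) * z) * exp (of_real q * z))) \<le> C * exp (- (pi * (2 - \<alpha>) / 8 * \<bar>Im z\<bar>))"
proof -
  \<comment> \<open>Half of the limiting rate is taken, as some strict loss is required.\<close>
  have "pi * (2 - \<alpha>) / 8 < pi * (2 - \<alpha>) / 4" using \<alpha> by (simp add: field_simps)
  then obtain C where C: "\<And>z. \<bar>Re z\<bar> \<le> A \<Longrightarrow> 1 \<le> \<bar>Im z\<bar> \<Longrightarrow>
     norm (Gamma z * rGamma (of_real (\<alpha> / 2) * z)) \<le> C * exp (- (pi * (2 - \<alpha>) / 8 * \<bar>Im z\<bar>))"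
    using Gamma_rGamma_exponential_decay[OF \<alpha>(1)] by metis
  show ?thesis
  proof (intro exI allI impI)
    fix z :: complex assume z: "\<bar>Re z\<bar> \<le> A" "1 \<le> \<bar>Im z\<bar>"
    have "q * Re z \<le> \<bar>q\<bar> * A"
      by (rule order_trans[OF abs_ge_self]) (use z(1) in \<open>auto simp: abs_mult intro: mult_left_mono\<close>)
    hence "norm (Gamma z * rGamma (of_real (\<alpha> / 2) * z)) * norm (exp (of_real q * z))
        \<le> (C * exp (- (pi * (2 - \<alpha>) / 8 * \<bar>Im z\<bar>))) * exp (\<bar>q\<bar> * A)"
      using order_trans[OF norm_ge_zero C[OF z]] by (intro mult_mono C z) auto
    thus "norm (Gamma z * (rGamma (of_real (\<alpha> / 2) * z) * exp (of_real q * z)))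
        \<le> (C * exp (\<bar>q\<bar> * A)) * exp (- (pi * (2 - \<alpha>) / 8 * \<bar>Im z\<bar>))"
      by (simp add: norm_mult mult_ac)
  qed
qed

lemma kernel_rate_pos: "0 < pi * (2 - \<alpha>) / 8"
  using \<alpha> by simp

lemmas kernel_integrable_vertical =
  integrable_Gamma_vertical[OF kernel_holomorphic kernel_rate_pos kernel_decay]

lemmas kernel_shift =
  Gamma_contour_shift[OF kernel_holomorphic kernel_rate_pos kernel_decay]

text \<open>\<open>Gamma_contour_shift\<close> ends on lines to the left of 0, so two lines on the
  right are compared by moving both to Re z = -1/2; they collect the same residue at 0.\<close>

lemma subordinator_kernel_line:
  assumes c: "0 < c"
  shows "subordinator_kernel \<alpha> q = 1 / (2 * pi) *
     (LINT y|lborel. Gamma (Complex c y) * (rGamma (of_real (\<alpha> / 2) * Complex c y) * exp (of_real q * Complex c y)))"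
  unfolding subordinator_kernel_def
  using kernel_shift[OF zero_less_one refl, of q 0] kernel_shift[OF c refl, of q 0] by simp

lemma norm_kernel_line_le:
  "norm (LINT y|lborel. Gamma (Complex c y) * (rGamma (of_real (\<alpha> / 2) * Complex c y) * exp (of_real q * Complex c y)))
    \<le> (LINT y|lborel. norm (Gamma (Complex c y) * rGamma (of_real (\<alpha> / 2) * Complex c y))) * exp (c * q)"
proof -
  have eq: "norm (Gamma (Complex c y) * (rGamma (of_real (\<alpha> / 2) * Complex c y) * exp (of_real q * Complex c y)))
      = norm (Gamma (Complex c y) * rGamma (of_real (\<alpha> / 2) * Complex c y)) * exp (c * q)" for y
    by (simp add: norm_mult mult_ac)
  show ?thesis
    by (rule order_trans[OF integral_norm_bound], unfold eq) simp
qed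

text \<open>On the line Re z = c the factor exp (q z) has constant modulus exp (c q). The freedom in
  c is the point: a larger c gives more decay as q tends to minus infinity, a smaller one less
  growth at plus infinity.\<close>

lemma subordinator_kernel_bound:
  assumes c: "0 < c"
  obtains M where "0 \<le> M" "\<And>q. norm (subordinator_kernel \<alpha> q) \<le> M * exp (c * q)"
proof (rule that)
  fix q
  let ?M = "1 / (2 * pi) * (LINT y|lborel. norm (Gamma (Complex c y) * rGamma (of_real (\<alpha> / 2) * Complex c y)))"
  show "norm (subordinator_kernel \<alpha> q) \<le> ?M * exp (c * q)"
    unfolding subordinator_kernel_line[OF c] using norm_kernel_line_le[of c q]
    by (simp add: norm_mult norm_divide divide_right_mono)
qed simp

lemma subordinator_kernel_expansion:
  obtains M where "\<And>q. norm (subordinator_kernel \<alpha> q -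
      (\<Sum>n=1..N. (-1)^n / fact n * rGamma (- complex_of_real (\<alpha> / 2 * real n)) * complex_of_real (exp (- real n * q))))
    \<le> M * exp (- (real N + 1/2) * q)"
proof (rule that)
  fix q
  define b where "b = - real N - 1/2"
  define J where "J = (LINT y|lborel. Gamma (Complex b y) * (rGamma (of_real (\<alpha> / 2) * Complex b y) * exp (of_real q * Complex b y)))"
  let ?M = "1 / (2 * pi) * (LINT y|lborel. norm (Gamma (Complex b y) * rGamma (of_real (\<alpha> / 2) * Complex b y)))"
  let ?h = "\<lambda>n. (-1)^n / fact n * (rGamma (of_real (\<alpha> / 2) * (- complex_of_nat n)) * exp (of_real q * (- complex_of_nat n)))"
  have "subordinator_kernel \<alpha> q = 1 / (2 * pi) * (2 * pi * (\<Sum>n\<le>N. ?h n) + J)"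
    unfolding subordinator_kernel_def J_def using kernel_shift[OF zero_less_one b_def, of q] by simp
  \<comment> \<open>The term n = 0 drops out because \<open>rGamma 0 = 0\<close>: this is the
    cancelled pole at 0.\<close>
  also have "(\<Sum>n\<le>N. ?h n) = (\<Sum>n=1..N. ?h n)"
    by (rule sum.mono_neutral_right) (auto simp: not_less_eq_eq Suc_le_eq)
  also have "\<dots> = (\<Sum>n=1..N. (-1)^n / fact n * rGamma (- complex_of_real (\<alpha> / 2 * real n)) * complex_of_real (exp (- real n * q)))"
    by (intro sum.cong refl) (simp add: mult_ac flip: exp_of_real)
  finally have "subordinator_kernel \<alpha> q - (\<Sum>n=1..N. (-1)^n / fact n * rGamma (- complex_of_real (\<alpha> / 2 * real n)) * complex_of_real (exp (- real n * q)))
     = 1 / (2 * pi) * J" by (simp add: field_simps)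
  also have "norm \<dots> \<le> ?M * exp (b * q)"
    using norm_kernel_line_le[of b q] by (simp add: J_def norm_mult norm_divide divide_right_mono)
  also have "b = - (real N + 1/2)" by (simp add: b_def)
  finally show "norm (subordinator_kernel \<alpha> q - (\<Sum>n=1..N. (-1)^n / fact n * rGamma (- complex_of_real (\<alpha> / 2 * real n)) * complex_of_real (exp (- real n * q))))
     \<le> (1 / (2 * pi) * (LINT y|lborel. norm (Gamma (Complex (- (real N + 1/2)) y) * rGamma (of_real (\<alpha> / 2) * Complex (- (real N + 1/2)) y)))) * exp (- (real N + 1/2) * q)" .
qed

lemma measurable_subordinator_kernel [measurable]: "subordinator_kernel \<alpha> \<in> borel_measurable borel"
proof -
  note [measurable] = measurable_Gamma_vertical[of 1, simplified]
  show ?thesis unfolding subordinator_kernel_def by measurable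
qed

end

section \<open>Fubini and the Gaussian mixture\<close>

lemma integrable_pair_dominated:
  fixes F :: "real \<times> real \<Rightarrow> complex" and a b :: "real \<Rightarrow> real"
  assumes [measurable]: "F \<in> borel_measurable (lborel \<Otimes>\<^sub>M lborel)"
    and a: "integrable lborel a" and b: "integrable lborel b"
    and bound: "\<And>x y. norm (F (x, y)) \<le> a x * b y"
  shows "integrable (lborel \<Otimes>\<^sub>M lborel) F"
proof -
  have [measurable]: "a \<in> borel_measurable borel" "b \<in> borel_measurable borel" using a b by auto
  have "integrable (lborel \<Otimes>\<^sub>M lborel) (\<lambda>(x, y). a x * b y)"
    by (rule lborel_pair.Fubini_integrable) (use a b in \<open>auto simp: abs_mult\<close>)
  thus ?thesis
    by (rule Bochner_Integration.integrable_bound) (auto intro!: AE_I2 order_trans[OF bound] simp: case_prod_beta)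
qed

context
  fixes \<alpha> :: real
  assumes \<alpha>: "0 < \<alpha>" "\<alpha> < 2"
begin

lemma kernel_abs_integrable_vertical:
  assumes "0 < c"
  shows "integrable lborel (\<lambda>y. norm (Gamma (Complex c y) * rGamma (of_real (\<alpha> / 2) * Complex c y)))"
  using kernel_integrable_vertical[OF \<alpha> of_real_pos_notin_nonpos_Ints[OF assms], of 0] by simp

text \<open>A Parseval formula: pairing the kernel with h amounts to integrating \<Gamma>
  \<open>rGamma\<close> along a vertical line against the Mellin transform of h at \<alpha>w/2. On
  Re w = c the double integrand has modulus equal to a function of y times a function of v, so
  absolute convergence splits into two one-dimensional conditions. It is applied to a Laplace factor
  in \<open>subordination\<close> and to the heat kernel in
  \<open>mellin_barnes_representation\<close>.\<close>

lemma kernel_swap: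
  fixes h :: "real \<Rightarrow> complex" and l :: real
  assumes c: "0 < c" and h [measurable]: "h \<in> borel_measurable borel"
    and int: "integrable lborel (\<lambda>v. exp (\<alpha> * c / 2 * v) * norm (h v))"
  defines "G \<equiv> \<lambda>y. Gamma (Complex c y) * rGamma (of_real (\<alpha> / 2) * Complex c y) * exp (- of_real l * Complex c y)"
  shows "integrable lborel (\<lambda>y. G y * (LINT v|lborel. exp (of_real (\<alpha> / 2) * Complex c y * of_real v) * h v))"
    and "(LINT v|lborel. subordinator_kernel \<alpha> (\<alpha> * v / 2 - l) * h v) =
      1 / (2 * pi) * (LINT y|lborel. G y * (LINT v|lborel. exp (of_real (\<alpha> / 2) * Complex c y * of_real v) * h v))"
proof -
  define F where "F = (\<lambda>(y, v). G y * (exp (of_real (\<alpha> / 2) * Complex c y * of_real v) * h v))"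
  note [measurable] = measurable_Gamma_vertical[OF c]
  have [measurable]: "G \<in> borel_measurable borel" unfolding G_def by measurable
  have F: "integrable (lborel \<Otimes>\<^sub>M lborel) F"
  proof (rule integrable_pair_dominated)
    show "F \<in> borel_measurable (lborel \<Otimes>\<^sub>M lborel)" unfolding F_def by measurable
    show "integrable lborel (\<lambda>y. norm (Gamma (Complex c y) * rGamma (of_real (\<alpha> / 2) * Complex c y)) * exp (- l * c))"
      using kernel_abs_integrable_vertical[OF c] by (intro integrable_mult_left) auto
    show "integrable lborel (\<lambda>v. exp (\<alpha> * c / 2 * v) * norm (h v))" by (rule int)
    show "norm (F (y, v)) \<le> norm (Gamma (Complex c y) * rGamma (of_real (\<alpha> / 2) * Complex c y)) * exp (- l * c) * (exp (\<alpha> * c / 2 * v) * norm (h v))" for y v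
      by (simp add: F_def G_def norm_mult mult_ac)
  qed
  have inner: "(LINT v|lborel. F (y, v)) = G y * (LINT v|lborel. exp (of_real (\<alpha> / 2) * Complex c y * of_real v) * h v)" for y
    unfolding F_def prod.case by (rule integral_mult_right_zero)
  show "integrable lborel (\<lambda>y. G y * (LINT v|lborel. exp (of_real (\<alpha> / 2) * Complex c y * of_real v) * h v))"
    using lborel_pair.integrable_fst'[OF F] unfolding inner .
  have "(LINT v|lborel. subordinator_kernel \<alpha> (\<alpha> * v / 2 - l) * h v) = (LINT v|lborel. 1 / (2 * pi) * (LINT y|lborel. F (y, v)))"
  proof (rule Bochner_Integration.integral_cong[OF refl])
    fix v :: real
    have "Gamma (Complex c y) * (rGamma (of_real (\<alpha> / 2) * Complex c y) * exp (of_real (\<alpha> * v / 2 - l) * Complex c y)) * h v = F (y, v)" for y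
    proof -
      have "of_real (\<alpha> * v / 2 - l) * Complex c y = - of_real l * Complex c y + of_real (\<alpha> / 2) * Complex c y * of_real v"
        by (simp add: algebra_simps)
      thus ?thesis unfolding F_def G_def prod.case by (simp only: exp_add mult_ac)
    qed
    thus "subordinator_kernel \<alpha> (\<alpha> * v / 2 - l) * h v = 1 / (2 * pi) * (LINT y|lborel. F (y, v))"
      unfolding subordinator_kernel_line[OF \<alpha> c] mult.assoc integral_mult_left_zero[symmetric] by simp
  qed
  also have "\<dots> = 1 / (2 * pi) * (LINT v|lborel. (LINT y|lborel. F (y, v)))"
    by simp
  also have "(LINT v|lborel. (LINT y|lborel. F (y, v))) = (LINT y|lborel. (LINT v|lborel. F (y, v)))"
    using lborel_pair.Fubini_integral[of "\<lambda>y v. F (y, v)"] F by simp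
  finally show "(LINT v|lborel. subordinator_kernel \<alpha> (\<alpha> * v / 2 - l) * h v) =
      1 / (2 * pi) * (LINT y|lborel. G y * (LINT v|lborel. exp (of_real (\<alpha> / 2) * Complex c y * of_real v) * h v))"
    unfolding inner .
qed

text \<open>The Laplace transform of the subordinator. The inner integral of
  \<open>kernel_swap\<close> is \<Gamma>(\<alpha>w/2) s powr (- \<alpha>w/2); its Gamma factor
  cancels \<open>rGamma\<close>, and what remains is the Cahen-Mellin integral.\<close>

lemma subordination:
  assumes t: "0 < t" and s: "0 < s"
  shows "(LINT v|lborel. subordinator_kernel \<alpha> (\<alpha> * v / 2 - ln t) * of_real (exp (- s * exp v)))
    = of_real (exp (- t * s powr (\<alpha> / 2)))"
proof -
  \<comment> \<open>Then exp (- q) = t s powr (\<alpha>/2), the desired exponent.\<close>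
  define q where "q = - ln t - \<alpha> / 2 * ln s"
  have "integrable lborel (\<lambda>v. norm (exp (of_real (\<alpha> / 2) * of_real v) * complex_of_real (exp (- s * exp v))))"
    using Gamma_exp_integral(1)[of "of_real (\<alpha> / 2)" s] \<alpha> s by (intro integrable_norm) auto
  hence int: "integrable lborel (\<lambda>v. exp (\<alpha> * 1 / 2 * v) * norm (complex_of_real (exp (- s * exp v))))"
    by (simp add: norm_mult)
  have "(LINT v|lborel. subordinator_kernel \<alpha> (\<alpha> * v / 2 - ln t) * of_real (exp (- s * exp v))) =
     1 / (2 * pi) * (LINT y|lborel. Gamma (Complex 1 y) * rGamma (of_real (\<alpha> / 2) * Complex 1 y) * exp (- of_real (ln t) * Complex 1 y) *
        (LINT v|lborel. exp (of_real (\<alpha> / 2) * Complex 1 y * of_real v) * of_real (exp (- s * exp v))))"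
    by (rule kernel_swap(2)[OF zero_less_one _ int]) measurable
  also have "(\<lambda>y. Gamma (Complex 1 y) * rGamma (of_real (\<alpha> / 2) * Complex 1 y) * exp (- of_real (ln t) * Complex 1 y) *
        (LINT v|lborel. exp (of_real (\<alpha> / 2) * Complex 1 y * of_real v) * of_real (exp (- s * exp v))))
      = (\<lambda>y. Gamma (Complex 1 y) * exp (of_real q * Complex 1 y))"
  proof
    fix y :: real
    define z where "z = of_real (\<alpha> / 2) * Complex 1 y"
    have z: "Re z > 0" using \<alpha> by (simp add: z_def)
    hence "z \<notin> \<int>\<^sub>\<le>\<^sub>0" by (auto elim!: nonpos_Ints_cases')
    hence "rGamma z * Gamma z = 1" by (simp add: rGamma_inverse_Gamma Gamma_eq_zero_iff)
    moreover have "exp (- of_real (ln t) * Complex 1 y) * exp (- z * of_real (ln s)) = exp (of_real q * Complex 1 y)"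
      unfolding exp_add[symmetric] by (rule arg_cong[where f = exp]) (simp add: q_def z_def algebra_simps)
    ultimately show "Gamma (Complex 1 y) * rGamma (of_real (\<alpha> / 2) * Complex 1 y) * exp (- of_real (ln t) * Complex 1 y) *
        (LINT v|lborel. exp (of_real (\<alpha> / 2) * Complex 1 y * of_real v) * of_real (exp (- s * exp v)))
       = Gamma (Complex 1 y) * exp (of_real q * Complex 1 y)"
      unfolding z_def[symmetric] Gamma_exp_integral(2)[OF z s]
      by (metis (no_types, opaque_lifting) mult.assoc mult.commute mult.right_neutral)
  qed
  also have "1 / (2 * pi) * (LINT y|lborel. Gamma (Complex 1 y) * exp (of_real q * Complex 1 y)) = of_real (exp (- exp (- q)))"
    unfolding Cahen_Mellin(2)[OF zero_less_one] by simp
  also have "exp (- q) = t * s powr (\<alpha> / 2)"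
    using t s by (simp add: q_def exp_add powr_def)
  finally show ?thesis by simp
qed

text \<open>The line Re w = d/\<alpha> exactly balances the weight exp (- d v / 2). Taking a line
  slightly to its right for v \<le> 0 and slightly to its left for v > 0 gives decay at both
  ends.\<close>

lemma subordinator_kernel_weighted_integrable:
  assumes d: "1 \<le> d"
  shows "integrable lborel (\<lambda>v. norm (subordinator_kernel \<alpha> (\<alpha> * v / 2 - l)) * exp (- d / 2 * v))"
proof -
  \<comment> \<open>The shifts by 1/2 in d yield exp (- |v| / 4); d \<ge> 1 keeps d - 1/2
    positive.\<close>
  obtain M1 where M1: "0 \<le> M1" "\<And>q. norm (subordinator_kernel \<alpha> q) \<le> M1 * exp ((d + 1/2) / \<alpha> * q)"
    using subordinator_kernel_bound[OF \<alpha>, of "(d + 1/2) / \<alpha>"] d \<alpha> by auto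
  obtain M2 where M2: "0 \<le> M2" "\<And>q. norm (subordinator_kernel \<alpha> q) \<le> M2 * exp ((d - 1/2) / \<alpha> * q)"
    using subordinator_kernel_bound[OF \<alpha>, of "(d - 1/2) / \<alpha>"] d \<alpha> by auto
  define M where "M = M1 * exp (- (d + 1/2) / \<alpha> * l) + M2 * exp (- (d - 1/2) / \<alpha> * l)"
  have aux: "exp (e / \<alpha> * (\<alpha> * v / 2 - l)) * exp (- d / 2 * v) = exp (- e / \<alpha> * l) * exp ((e - d) / 2 * v)" for e v
    unfolding exp_add[symmetric] using \<alpha> by (intro arg_cong[where f = exp]) (simp add: field_simps)
  have bound: "norm (subordinator_kernel \<alpha> (\<alpha> * v / 2 - l)) * exp (- d / 2 * v) \<le> M * exp (- (1/4 * \<bar>v\<bar>))" for v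
  proof (cases "v \<le> 0")
    case True
    have "norm (subordinator_kernel \<alpha> (\<alpha> * v / 2 - l)) * exp (- d / 2 * v)
        \<le> M1 * exp ((d + 1/2) / \<alpha> * (\<alpha> * v / 2 - l)) * exp (- d / 2 * v)"
      by (intro mult_right_mono M1) auto
    also have "\<dots> = M1 * exp (- (d + 1/2) / \<alpha> * l) * exp (- (1/4 * \<bar>v\<bar>))"
      using True unfolding mult.assoc aux by simp
    also have "\<dots> \<le> M * exp (- (1/4 * \<bar>v\<bar>))"
      using M1 M2 by (intro mult_right_mono) (auto simp: M_def)
    finally show ?thesis .
  next
    case False
    have "norm (subordinator_kernel \<alpha> (\<alpha> * v / 2 - l)) * exp (- d / 2 * v)
        \<le> M2 * exp ((d - 1/2) / \<alpha> * (\<alpha> * v / 2 - l)) * exp (- d / 2 * v)"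
      by (intro mult_right_mono M2) auto
    also have "\<dots> = M2 * exp (- (d - 1/2) / \<alpha> * l) * exp (- (1/4 * \<bar>v\<bar>))"
      using False unfolding mult.assoc aux by simp
    also have "\<dots> \<le> M * exp (- (1/4 * \<bar>v\<bar>))"
      using M1 M2 by (intro mult_right_mono) (auto simp: M_def)
    finally show ?thesis .
  qed
  have "integrable lborel (\<lambda>v. M * exp (- (1/4 * \<bar>v\<bar>)))"
    using integrable_exp_minus_abs[of "1/4"] by (intro integrable_mult_right) auto
  thus ?thesis
  proof (rule Bochner_Integration.integrable_bound)
    note [measurable] = measurable_subordinator_kernel[OF \<alpha>]
    show "(\<lambda>v. norm (subordinator_kernel \<alpha> (\<alpha> * v / 2 - l)) * exp (- d / 2 * v)) \<in> borel_measurable lborel"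
      by measurable
    next
    have "0 \<le> M" using M1 M2 by (simp add: M_def)
    thus "AE v in lborel. norm (norm (subordinator_kernel \<alpha> (\<alpha> * v / 2 - l)) * exp (- d / 2 * v)) \<le> norm (M * exp (- (1/4 * \<bar>v\<bar>)))"
      using bound by (simp add: abs_mult)
  qed
qed

text \<open>The stable density as a mixture of heat kernels at times s = exp v. The L1 norm in \<xi>
  of each Gaussian is a multiple of exp (- d v / 2), so
  \<open>subordinator_kernel_weighted_integrable\<close> is just what Fubini asks for.\<close>

lemma stable_density_subordination:
  fixes x :: "'a::euclidean_space"
  assumes t: "0 < t"
  defines "d \<equiv> real DIM('a)"
  defines "\<rho> \<equiv> (norm x)\<^sup>2 / 4"
  shows "stable_density \<alpha> t x = of_real ((2 * pi) powr (- d) * pi powr (d / 2)) *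
    (LINT v|lborel. subordinator_kernel \<alpha> (\<alpha> * v / 2 - ln t) * of_real (exp (- d / 2 * v) * exp (- \<rho> * exp (- v))))"
proof -
  have d1: "1 \<le> d" unfolding d_def using DIM_positive[where 'a = 'a] by simp
  note [measurable] = measurable_subordinator_kernel[OF \<alpha>]
  define k where "k v = subordinator_kernel \<alpha> (\<alpha> * v / 2 - ln t)" for v
  have [measurable]: "k \<in> borel_measurable borel" unfolding k_def by measurable
  define g where "g x' v \<xi> = exp (- \<i> * of_real (x' \<bullet> \<xi>)) * complex_of_real (exp (- exp v * (norm \<xi>)\<^sup>2))"
    for x' \<xi> :: 'a and v
  define F where "F = (\<lambda>(v, \<xi>::'a). k v * g x v \<xi>)"
  have powr_eq: "(pi / exp v) powr (d / 2) = pi powr (d / 2) * exp (- d / 2 * v)" for v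
    by (simp add: powr_divide exp_powr_real exp_minus field_simps)
  have gint: "integrable lborel (g x' v)" for x' v
    unfolding g_def by (rule gaussian_fourier(1)) simp
  have gval: "(LINT \<xi>|lborel. g x' v \<xi>) = of_real (pi powr (d / 2) * (exp (- d / 2 * v) * exp (- ((norm x')\<^sup>2 / 4) * exp (- v))))" for x' v
    unfolding g_def gaussian_fourier(2)[OF exp_gt_zero] d_def[symmetric] powr_eq
    by (simp add: exp_minus field_simps)
  \<comment> \<open>The modulus of the integrand at x is the integrand at 0, so the norm is read off
    from the transform at 0.\<close>
  have gnorm: "(LINT \<xi>|lborel. norm (g x v \<xi>)) = pi powr (d / 2) * exp (- d / 2 * v)" for v
  proof -
    have "norm (g x v \<xi>) = norm (g 0 v \<xi>)" for \<xi> by (simp add: g_def norm_mult)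
    moreover have "complex_of_real (norm (g 0 v \<xi>)) = g 0 v \<xi>" for \<xi> by (simp add: g_def)
    ultimately have "complex_of_real (LINT \<xi>|lborel. norm (g x v \<xi>)) = (LINT \<xi>|lborel. g 0 v \<xi>)"
      by (simp add: integral_complex_of_real[symmetric] del: integral_complex_of_real)
    also have "\<dots> = complex_of_real (pi powr (d / 2) * exp (- d / 2 * v))"
      unfolding gval by simp
    finally show ?thesis by (simp only: of_real_eq_iff)
  qed
  have inner: "(LINT \<xi>|lborel. F (v, \<xi>)) = of_real (pi powr (d / 2)) * (k v * of_real (exp (- d / 2 * v) * exp (- \<rho> * exp (- v))))" for v
    unfolding F_def prod.case integral_mult_right_zero gval \<rho>_def by (simp only: of_real_mult mult_ac)
  have F: "integrable (lborel \<Otimes>\<^sub>M lborel) F"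
  proof (rule lborel_pair.Fubini_integrable)
    show "F \<in> borel_measurable (lborel \<Otimes>\<^sub>M lborel)" unfolding F_def g_def by measurable
    have "(LINT \<xi>|lborel. norm (F (v, \<xi>))) = pi powr (d / 2) * (norm (k v) * exp (- d / 2 * v))" for v
      by (simp add: F_def norm_mult gnorm)
    thus "integrable lborel (\<lambda>v. LINT \<xi>|lborel. norm (F (v, \<xi>)))"
      using subordinator_kernel_weighted_integrable[OF d1, of "ln t"] by (simp add: k_def)
    show "AE v in lborel. integrable lborel (\<lambda>\<xi>. F (v, \<xi>))"
      unfolding F_def prod.case by (intro AE_I2 integrable_mult_right gint)
  qed
  have "(LINT \<xi>|lborel. exp (- \<i> * complex_of_real (x \<bullet> \<xi>)) * complex_of_real (exp (- t * norm \<xi> powr \<alpha>)))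
      = (LINT \<xi>|lborel. (LINT v|lborel. F (v, \<xi>)))"
  proof (rule integral_cong_AE)
    show "(\<lambda>\<xi>. LINT v|lborel. F (v, \<xi>)) \<in> borel_measurable lborel"
      unfolding F_def g_def by measurable
    \<comment> \<open>Only almost everywhere: \<open>subordination\<close> requires |\<xi>|^2 > 0,
      so the origin is left out.\<close>
    show "AE \<xi> in lborel. exp (- \<i> * complex_of_real (x \<bullet> \<xi>)) * complex_of_real (exp (- t * norm \<xi> powr \<alpha>)) = (LINT v|lborel. F (v, \<xi>))"
      using AE_lborel_singleton[of "0::'a"]
    proof eventually_elim
      fix \<xi> :: 'a assume "\<xi> \<noteq> 0"
      hence pos: "0 < (norm \<xi>)\<^sup>2" by simp
      have "(LINT v|lborel. F (v, \<xi>)) = (LINT v|lborel. exp (- \<i> * complex_of_real (x \<bullet> \<xi>)) *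
          (subordinator_kernel \<alpha> (\<alpha> * v / 2 - ln t) * of_real (exp (- (norm \<xi>)\<^sup>2 * exp v))))"
        by (simp add: F_def g_def k_def mult_ac)
      also have "\<dots> = exp (- \<i> * complex_of_real (x \<bullet> \<xi>)) * of_real (exp (- t * ((norm \<xi>)\<^sup>2) powr (\<alpha> / 2)))"
        unfolding integral_mult_right_zero subordination[OF t pos] ..
      also have "((norm \<xi>)\<^sup>2) powr (\<alpha> / 2) = norm \<xi> powr \<alpha>"
        using \<open>\<xi> \<noteq> 0\<close> by (simp add: powr_powr flip: powr_numeral)
      finally show "exp (- \<i> * complex_of_real (x \<bullet> \<xi>)) * complex_of_real (exp (- t * norm \<xi> powr \<alpha>)) = (LINT v|lborel. F (v, \<xi>))" ..
    qed
  qed measurable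
  also have "\<dots> = (LINT v|lborel. (LINT \<xi>|lborel. F (v, \<xi>)))"
    using lborel_pair.Fubini_integral[of "\<lambda>v \<xi>. F (v, \<xi>)"] F by simp
  also have "\<dots> = (LINT v|lborel. of_real (pi powr (d / 2)) * (k v * of_real (exp (- d / 2 * v) * exp (- \<rho> * exp (- v)))))"
    by (simp only: inner)
  also have "\<dots> = of_real (pi powr (d / 2)) * (LINT v|lborel. k v * of_real (exp (- d / 2 * v) * exp (- \<rho> * exp (- v))))"
    by (rule integral_mult_right_zero)
  finally show ?thesis
    unfolding stable_density_def d_def[symmetric] k_def by (simp only: of_real_mult mult.assoc)
qed

end

section \<open>Mellin-Barnes representation and asymptotic expansion\<close>

text \<open>With \<rho> = |x|^2 / 4 and r = t powr (-1/\<alpha>) |x|, the last factor on the left is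
  \<rho> powr (- d/2) times r powr d: it converts powers of \<rho> from the Gamma integral into
  powers of r.\<close>

lemma gaussian_weight_constant:
  fixes t d \<alpha> :: real
  assumes "0 < t"
  shows "(2 * pi) powr (- d) * pi powr (d / 2) * exp (d * ln 2 - d / \<alpha> * ln t) = t powr (- d / \<alpha>) / pi powr (d / 2)"
proof -
  have "(2 * pi) powr (- d) = exp (- d * (ln 2 + ln pi))" "pi powr (d / 2) = exp (d / 2 * ln pi)"
    by (simp_all add: powr_def ln_mult)
  hence "(2 * pi) powr (- d) * pi powr (d / 2) * exp (d * ln 2 - d / \<alpha> * ln t)
     = exp (- d * (ln 2 + ln pi) + d / 2 * ln pi + (d * ln 2 - d / \<alpha> * ln t))"
    by (simp only: exp_add)
  also have "\<dots> = exp (- d / \<alpha> * ln t - d / 2 * ln pi)"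
    by (rule arg_cong[where f = exp]) (simp add: algebra_simps)
  also have "\<dots> = t powr (- d / \<alpha>) / pi powr (d / 2)"
    using assms by (simp add: powr_def exp_diff)
  finally show ?thesis .
qed

lemma mb_integrand_exp:
  assumes r: "0 < r"
  shows "mb_integrand d \<alpha> r z = Gamma (z / of_real \<alpha>) * rGamma (z / 2) * Gamma ((of_nat d - z) / 2) *
     exp ((z - of_nat d) * of_real (ln r) - z * of_real (ln 2))"
proof -
  have "Ln 2 = complex_of_real (ln 2)" using Ln_of_real[of 2] by simp
  moreover have "Ln (complex_of_real r) = of_real (ln r)" using r by (rule Ln_of_real)
  moreover have "exp ((z - of_nat d) * of_real (ln r) - z * of_real (ln 2)) =
      exp (- z * of_real (ln 2)) * exp ((- of_nat d + z) * of_real (ln r))"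
    unfolding exp_add[symmetric] by (rule arg_cong[where f = exp]) (simp add: algebra_simps)
  ultimately show ?thesis
    using r unfolding mb_integrand_def powr_def rGamma_inverse_Gamma divide_inverse by simp
qed

context
  fixes \<alpha> :: real
  assumes \<alpha>: "0 < \<alpha>" "\<alpha> < 2"
begin

text \<open>Apply \<open>kernel_swap\<close> on Re w = c/\<alpha> to the heat kernel. With z =
  \<alpha>w the inner integral is Euler's integral at (d - z)/2, convergent because c < d, and it
  supplies the second Gamma factor.\<close>

lemma mellin_barnes_representation:
  fixes x :: "'a::euclidean_space"
  assumes c: "0 < c" "c < real DIM('a)" and t: "0 < t" and x: "x \<noteq> 0"
  defines "r \<equiv> t powr (-1/\<alpha>) * norm x"
  shows "integrable lborel (\<lambda>y. mb_integrand DIM('a) \<alpha> r (Complex c y))"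
    and "stable_density \<alpha> t x =
      of_real (t powr (- real DIM('a) / \<alpha>) / (\<alpha> * pi powr (real DIM('a) / 2))) * (1 / (2 * pi * \<i>)) *
      (LINT y|lborel. mb_integrand DIM('a) \<alpha> r (Complex c y) * \<i>)"
proof -
  define d where "d = real DIM('a)"
  define \<rho> where "\<rho> = (norm x)\<^sup>2 / 4"
  define c1 where "c1 = c / \<alpha>"
  define h where "h = (\<lambda>v. complex_of_real (exp (- d / 2 * v) * exp (- \<rho> * exp (- v))))"
  define K0 where "K0 = exp (d * ln 2 - d / \<alpha> * ln t)"
  define mb where "mb y = mb_integrand DIM('a) \<alpha> r (Complex c y)" for y
  define G where "G y = Gamma (Complex c1 y) * rGamma (of_real (\<alpha> / 2) * Complex c1 y) * exp (- of_real (ln t) * Complex c1 y)" for y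
  have \<rho>: "0 < \<rho>" using x by (simp add: \<rho>_def)
  have r: "0 < r" using x t by (simp add: r_def)
  have c1: "0 < c1" using c \<alpha> by (simp add: c1_def)
  have ac1: "\<alpha> * c1 = c" using \<alpha> by (simp add: c1_def)
  have ln\<rho>: "ln \<rho> = 2 * ln (norm x) - 2 * ln 2"
    using x ln_realpow[of 2 2] by (simp add: \<rho>_def ln_div ln_realpow)
  have lnr: "ln r = ln (norm x) - ln t / \<alpha>"
    using x t by (simp add: r_def ln_mult ln_powr)
  have hm: "h \<in> borel_measurable borel" unfolding h_def by measurable
  have "integrable lborel (\<lambda>v. norm (exp (- of_real ((d - c) / 2) * of_real v) * complex_of_real (exp (- \<rho> * exp (- v)))))"
    using Gamma_exp_integral_reflected(1)[of "of_real ((d - c) / 2)" \<rho>] c \<rho> by (intro integrable_norm) (auto simp: d_def)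
  moreover have "norm (exp (- of_real ((d - c) / 2) * of_real v) * complex_of_real (exp (- \<rho> * exp (- v)))) = exp (\<alpha> * c1 / 2 * v) * norm (h v)" for v
    unfolding ac1 h_def by (simp add: norm_mult field_simps flip: exp_add)
  ultimately have int: "integrable lborel (\<lambda>v. exp (\<alpha> * c1 / 2 * v) * norm (h v))" by simp
  have point: "G y * (LINT v|lborel. exp (of_real (\<alpha> / 2) * Complex c1 y * of_real v) * h v) = of_real K0 * mb (0 + \<alpha> * y)" for y
  proof -
    define w where "w = Complex c1 y"
    define z where "z = of_real \<alpha> * w"
    define Z where "Z = (of_nat DIM('a) - z) / 2"
    have zc: "z = Complex c (0 + \<alpha> * y)" using ac1 by (simp add: z_def w_def complex_eq_iff)
    have Z: "Re Z > 0" using c by (simp add: Z_def zc)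
    have "exp (of_real (\<alpha> / 2) * Complex c1 y * of_real v) * h v = exp (- Z * of_real v) * of_real (exp (- \<rho> * exp (- v)))" for v
    proof -
      have "exp (of_real (\<alpha> / 2) * w * of_real v) * exp (of_real (- d / 2 * v)) = exp (- Z * of_real v)"
        unfolding exp_add[symmetric] by (rule arg_cong[where f = exp]) (simp add: Z_def z_def d_def field_simps)
      thus ?thesis by (simp add: h_def w_def[symmetric] flip: exp_of_real)
    qed
    hence inner: "(LINT v|lborel. exp (of_real (\<alpha> / 2) * Complex c1 y * of_real v) * h v) = Gamma Z * exp (- Z * of_real (ln \<rho>))"
      using Gamma_exp_integral_reflected(2)[OF Z \<rho>] by simp
    have w: "w = z / of_real \<alpha>" "of_real (\<alpha> / 2) * w = z / 2" using \<alpha> by (simp_all add: z_def)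
    have "exp (- of_real (ln t) * w) * exp (- Z * of_real (ln \<rho>)) =
       of_real K0 * exp ((z - of_nat DIM('a)) * of_real (ln r) - z * of_real (ln 2))"
      unfolding K0_def exp_of_real[symmetric] exp_add[symmetric] Z_def ln\<rho> lnr using \<alpha>
      by (intro arg_cong[where f = exp]) (simp add: z_def d_def field_simps)
    thus ?thesis
      unfolding inner
      unfolding mb_def G_def zc[symmetric] mb_integrand_exp[OF r] w_def[symmetric] w(2) Z_def[symmetric]
      unfolding w(1)[symmetric] by (simp add: mult_ac)
  qed
  have "integrable lborel (\<lambda>y. of_real K0 * mb (0 + \<alpha> * y))"
    using kernel_swap(1)[OF \<alpha> c1 hm int, of "ln t"] unfolding G_def[symmetric] point .
  hence "integrable lborel (\<lambda>y. mb (0 + \<alpha> * y))"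
    by (rule integrable_mult_right_cancel) (simp add: K0_def)
  hence "integrable lborel mb"
    using \<alpha> by (subst (asm) lborel_integrable_real_affine_iff) auto
  thus "integrable lborel (\<lambda>y. mb_integrand DIM('a) \<alpha> r (Complex c y))"
    unfolding mb_def .
  \<comment> \<open>The Jacobian of z = \<alpha>w; it produces the 1/\<alpha> of the
    prefactor.\<close>
  have mbs: "(LINT y|lborel. mb y) = of_real \<alpha> * (LINT y|lborel. mb (0 + \<alpha> * y))"
    using lborel_integral_real_affine[of \<alpha> mb 0] \<alpha> by (simp add: scaleR_conv_of_real)
  have "stable_density \<alpha> t x = of_real ((2 * pi) powr (- d) * pi powr (d / 2)) *
      (LINT v|lborel. subordinator_kernel \<alpha> (\<alpha> * v / 2 - ln t) * h v)"
    unfolding h_def d_def \<rho>_def by (rule stable_density_subordination[OF \<alpha> t])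
  also have "(LINT v|lborel. subordinator_kernel \<alpha> (\<alpha> * v / 2 - ln t) * h v) =
      1 / (2 * pi) * (LINT y|lborel. of_real K0 * mb (0 + \<alpha> * y))"
    using kernel_swap(2)[OF \<alpha> c1 hm int, of "ln t"] unfolding G_def[symmetric] point .
  also have "(LINT y|lborel. of_real K0 * mb (0 + \<alpha> * y)) = of_real K0 * (LINT y|lborel. mb (0 + \<alpha> * y))"
    by (rule integral_mult_right_zero)
  also have "of_real ((2 * pi) powr (- d) * pi powr (d / 2)) * (1 / (2 * pi) * (of_real K0 * (LINT y|lborel. mb (0 + \<alpha> * y))))
     = of_real ((2 * pi) powr (- d) * pi powr (d / 2) * K0) * (1 / (2 * pi) * (LINT y|lborel. mb (0 + \<alpha> * y)))"
    by (simp add: mult_ac)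
  also have "(2 * pi) powr (- d) * pi powr (d / 2) * K0 = t powr (- d / \<alpha>) / pi powr (d / 2)"
    unfolding K0_def by (rule gaussian_weight_constant[OF t])
  also have "of_real (t powr (- d / \<alpha>) / pi powr (d / 2)) * (1 / (2 * pi) * (LINT y|lborel. mb (0 + \<alpha> * y))) =
     of_real (t powr (- d / \<alpha>) / (\<alpha> * pi powr (d / 2))) * (1 / (2 * pi * \<i>)) * ((LINT y|lborel. mb y) * \<i>)"
    unfolding mbs using \<alpha> by (simp add: field_simps)
  finally show "stable_density \<alpha> t x =
      of_real (t powr (- real DIM('a) / \<alpha>) / (\<alpha> * pi powr (real DIM('a) / 2))) * (1 / (2 * pi * \<i>)) *
      (LINT y|lborel. mb_integrand DIM('a) \<alpha> r (Complex c y) * \<i>)"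
    unfolding mb_def d_def by (simp only: integral_mult_left_zero)
qed

text \<open>Again Euler's integral, at (d + e\<alpha>)/2. The exponent e is real so that the same
  formula serves the terms of the expansion (e = n) and its error bound (e a half-integer).\<close>

lemma weighted_power_integral:
  fixes d t e R :: real
  assumes t: "0 < t" and R: "0 < R" and d: "0 < d" and e: "0 \<le> e"
  defines "r \<equiv> t powr (-1/\<alpha>) * R"
  defines "f \<equiv> \<lambda>v. exp (- e * (\<alpha> * v / 2 - ln t)) * (exp (- d / 2 * v) * exp (- (R\<^sup>2 / 4) * exp (- v)))"
  shows "integrable lborel f"
    and "(LINT v|lborel. f v) = exp (d * ln 2 - d / \<alpha> * ln t) * (Gamma ((d + e * \<alpha>) / 2) * 2 powr (e * \<alpha>) * r powr (- d - e * \<alpha>))"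
proof -
  define \<rho> where "\<rho> = R\<^sup>2 / 4"
  define Z where "Z = (d + e * \<alpha>) / 2"
  have \<rho>: "0 < \<rho>" using R by (simp add: \<rho>_def)
  have Z: "0 < Z" using d e \<alpha> by (simp add: Z_def add_pos_nonneg)
  have ln\<rho>: "ln \<rho> = 2 * ln R - 2 * ln 2"
    using R ln_realpow[of 2 2] by (simp add: \<rho>_def ln_div ln_realpow)
  have lnr: "ln r = ln R - ln t / \<alpha>"
    using R t by (simp add: r_def ln_mult ln_powr)
  have r: "0 < r" using R t by (simp add: r_def)
  have f: "exp (- of_real Z * of_real v) * complex_of_real (exp (- \<rho> * exp (- v))) = of_real (exp (- e * ln t) * f v)" for v
  proof -
    have "exp (- e * ln t) * f v = exp (- Z * v) * exp (- \<rho> * exp (- v))"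
      unfolding f_def \<rho>_def exp_add[symmetric] by (rule arg_cong[where f = exp]) (simp add: Z_def field_simps)
    thus ?thesis by (simp flip: exp_of_real)
  qed
  have "integrable lborel (\<lambda>v. complex_of_real (exp (- e * ln t) * f v))"
    using Gamma_exp_integral_reflected(1)[of "of_real Z" \<rho>] Z \<rho> unfolding f by simp
  hence "integrable lborel (\<lambda>v. exp (- e * ln t) * f v)"
    by (simp only: complex_of_real_integrable_eq)
  thus "integrable lborel f" by (rule integrable_mult_right_cancel) simp
  have "complex_of_real (exp (- e * ln t) * (LINT v|lborel. f v)) = Gamma (of_real Z) * exp (- of_real Z * of_real (ln \<rho>))"
    using Gamma_exp_integral_reflected(2)[of "of_real Z" \<rho>] Z \<rho> unfolding f
    by (simp only: integral_complex_of_real integral_mult_right_zero Re_complex_of_real)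
  also have "\<dots> = of_real (Gamma Z * exp (- Z * ln \<rho>))"
    by (simp add: Gamma_complex_of_real flip: exp_of_real)
  finally have "exp (- e * ln t) * (LINT v|lborel. f v) = Gamma Z * exp (- Z * ln \<rho>)"
    by (simp only: of_real_eq_iff)
  hence "(LINT v|lborel. f v) = Gamma Z * (exp (- Z * ln \<rho>) * exp (e * ln t))"
    by (simp add: exp_minus field_simps)
  also have "exp (- Z * ln \<rho>) * exp (e * ln t) = exp (d * ln 2 - d / \<alpha> * ln t) * (exp (e * \<alpha> * ln 2) * exp ((- d - e * \<alpha>) * ln r))"
    unfolding exp_add[symmetric] Z_def ln\<rho> lnr using \<alpha> by (intro arg_cong[where f = exp]) (simp add: field_simps)
  finally show "(LINT v|lborel. f v) = exp (d * ln 2 - d / \<alpha> * ln t) * (Gamma ((d + e * \<alpha>) / 2) * 2 powr (e * \<alpha>) * r powr (- d - e * \<alpha>))"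
    using r by (simp add: powr_def Z_def mult_ac)
qed

text \<open>The indicator is already built into \<open>rGamma\<close>, which vanishes at the poles
  of \<Gamma>; this matches the coefficients with the residues of the kernel.\<close>

lemma asym_coeff_rGamma:
  "complex_of_real (asym_coeff d \<alpha> n) = (-1)^n / fact n * rGamma (- complex_of_real (\<alpha> / 2 * real n)) *
     of_real (Gamma ((real d + real n * \<alpha>) / 2) * 2 powr (real n * \<alpha>))"
proof -
  let ?g = "Gamma ((real d + real n * \<alpha>) / 2) * 2 powr (real n * \<alpha>)"
  have "asym_coeff d \<alpha> n = (-1)^n / fact n * rGamma (- (\<alpha> / 2 * real n)) * ?g"
  proof (cases "real n * \<alpha> / 2 \<in> \<int>")
    case True
    have "- (\<alpha> / 2 * real n) \<in> \<int>\<^sub>\<le>\<^sub>0"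
      using True \<alpha> by (auto simp: nonpos_Ints_altdef mult.commute)
    hence "rGamma (- (\<alpha> / 2 * real n)) = 0" by (simp add: rGamma_eq_zero_iff)
    thus ?thesis using True by (simp add: asym_coeff_def)
  next
    case False
    thus ?thesis by (simp add: asym_coeff_def rGamma_inverse_Gamma field_simps)
  qed
  moreover have "rGamma (- complex_of_real (\<alpha> / 2 * real n)) = of_real (rGamma (- (\<alpha> / 2 * real n)))"
    by (simp only: rGamma_complex_of_real flip: of_real_minus)
  ultimately show ?thesis by simp
qed

text \<open>The kernel expansion has an error bound for all v, so it may be integrated against the
  heat kernel with no splitting of the domain. By scaling, t enters only through r and the common
  prefactor, whence uniformity in t.\<close>

lemma stable_density_asymptotics:
  "\<exists>C. \<forall>t (x::'a::euclidean_space). 0 < t \<and> 1 \<le> t powr (-1/\<alpha>) * norm x \<longrightarrow>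
     norm (stable_density \<alpha> t x -
        complex_of_real (t powr (- real DIM('a) / \<alpha>) / pi powr (real DIM('a) / 2) *
          (\<Sum>n=1..N. asym_coeff DIM('a) \<alpha> n * (t powr (-1/\<alpha>) * norm x) powr (- real DIM('a) - real n * \<alpha>))))
     \<le> C * t powr (- real DIM('a) / \<alpha>) * (t powr (-1/\<alpha>) * norm x) powr (- real DIM('a) - real (N + 1) * \<alpha>)"
proof -
  define d where "d = real DIM('a)"
  have d: "0 < d" by (simp add: d_def)
  \<comment> \<open>The available lines lie at half-integers. Stopping after N terms would leave an
    error of order N + 1/2, short of the claimed N + 1; so N + 1 terms are expanded and the last one
    is counted as error, which explains both summands of C.\<close>
  define b where "b = real (N + 1) + 1/2"
  define a where "a n = (-1)^n / fact n * rGamma (- complex_of_real (\<alpha> / 2 * real n))" for n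
  define g where "g e = Gamma ((d + e * \<alpha>) / 2) * 2 powr (e * \<alpha>)" for e
  have g: "0 \<le> g b" using d \<alpha> by (auto simp: g_def b_def intro!: mult_nonneg_nonneg less_imp_le[OF Gamma_real_pos] divide_pos_pos add_pos_pos)
  obtain M where M: "\<And>q. norm (subordinator_kernel \<alpha> q - (\<Sum>n=1..N+1. a n * complex_of_real (exp (- real n * q)))) \<le> M * exp (- b * q)"
    unfolding a_def b_def by (rule subordinator_kernel_expansion[OF \<alpha>, of "N + 1"]) blast
  define C where "C = (\<bar>asym_coeff DIM('a) \<alpha> (N + 1)\<bar> + \<bar>M\<bar> * g b) / pi powr (d / 2)"
  have "norm (stable_density \<alpha> t x - of_real (t powr (- d / \<alpha>) / pi powr (d / 2) *
          (\<Sum>n=1..N. asym_coeff DIM('a) \<alpha> n * (t powr (-1/\<alpha>) * norm x) powr (- d - real n * \<alpha>))))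
     \<le> C * t powr (- d / \<alpha>) * (t powr (-1/\<alpha>) * norm x) powr (- d - real (N + 1) * \<alpha>)"
    if t: "0 < t" and r1: "1 \<le> t powr (-1/\<alpha>) * norm x" for t and x :: 'a
  proof -
    have x: "0 < norm x" using r1 t by (cases "x = 0") auto
    define r where "r = t powr (-1/\<alpha>) * norm x"
    define A where "A = (2 * pi) powr (- d) * pi powr (d / 2)"
    define K0 where "K0 = exp (d * ln 2 - d / \<alpha> * ln t)"
    define B where "B = t powr (- d / \<alpha>) / pi powr (d / 2)"
    have AK: "A * K0 = B" unfolding A_def K0_def B_def by (rule gaussian_weight_constant[OF t])
    have A0: "0 \<le> A" and B0: "0 \<le> B" by (auto simp: A_def B_def)
    define W where "W v = exp (- d / 2 * v) * exp (- ((norm x)\<^sup>2 / 4) * exp (- v))" for v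
    define q where "q v = \<alpha> * v / 2 - ln t" for v
    define I where "I e = (LINT v|lborel. exp (- e * q v) * W v)" for e
    note wpi = weighted_power_integral[OF t x d, folded W_def q_def r_def]
    have Iint: "integrable lborel (\<lambda>v. exp (- e * q v) * W v)" if "0 \<le> e" for e
      using wpi(1)[OF that] .
    have Ival: "I e = K0 * (g e * r powr (- d - e * \<alpha>))" if "0 \<le> e" for e
      unfolding I_def K0_def g_def using wpi(2)[OF that] .
    define S where "S v = (\<Sum>n=1..N+1. a n * of_real (exp (- real n * q v)))" for v
    define k where "k v = subordinator_kernel \<alpha> (q v)" for v
    note [measurable] = measurable_subordinator_kernel[OF \<alpha>]
    have [measurable]: "k \<in> borel_measurable borel" "S \<in> borel_measurable borel" "W \<in> borel_measurable borel"
      unfolding k_def S_def W_def q_def by measurable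
    have W0: "0 \<le> W v" for v by (simp add: W_def)
    have Iint': "integrable lborel (\<lambda>v. a n * of_real (exp (- real n * q v) * W v))" for n
      using Iint[of "real n"] by (intro integrable_mult_right) (simp only: complex_of_real_integrable_eq of_nat_0_le_iff)
    have S: "S v * of_real (W v) = (\<Sum>n=1..N+1. a n * of_real (exp (- real n * q v) * W v))" for v
      by (simp only: S_def sum_distrib_right of_real_mult mult.assoc)
    have Sint: "integrable lborel (\<lambda>v. S v * of_real (W v))"
      unfolding S by (intro Bochner_Integration.integrable_sum Iint')
    have Sval: "(LINT v|lborel. S v * of_real (W v)) = (\<Sum>n=1..N+1. a n * of_real (I (real n)))"
      unfolding S I_def by (subst Bochner_Integration.integral_sum[OF Iint']) (simp only: integral_mult_right_zero integral_complex_of_real)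
    have rem: "norm ((k v - S v) * of_real (W v)) \<le> \<bar>M\<bar> * (exp (- b * q v) * W v)" for v
    proof -
      have "norm ((k v - S v) * of_real (W v)) = norm (k v - S v) * W v"
        using W0 by (simp add: norm_mult)
      also have "\<dots> \<le> (M * exp (- b * q v)) * W v"
        unfolding k_def S_def by (intro mult_right_mono M W0)
      also have "\<dots> \<le> (\<bar>M\<bar> * exp (- b * q v)) * W v"
        by (intro mult_right_mono W0) auto
      finally show ?thesis by (simp add: mult.assoc)
    qed
    have b0: "0 \<le> b" by (simp add: b_def)
    have bint: "integrable lborel (\<lambda>v. \<bar>M\<bar> * (exp (- b * q v) * W v))"
      using Iint[OF b0] by (rule integrable_mult_right)
    have Eint: "integrable lborel (\<lambda>v. (k v - S v) * of_real (W v))"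
      by (rule Bochner_Integration.integrable_bound[OF bint]) (use rem W0 in \<open>auto simp: abs_mult intro!: AE_I2\<close>)
    define E where "E = (LINT v|lborel. (k v - S v) * of_real (W v))"
    have E: "norm E \<le> \<bar>M\<bar> * I b"
    proof -
      have "norm E \<le> (LINT v|lborel. norm ((k v - S v) * of_real (W v)))"
        unfolding E_def by (rule integral_norm_bound)
      also have "\<dots> \<le> (LINT v|lborel. \<bar>M\<bar> * (exp (- b * q v) * W v))"
        using rem by (intro integral_mono integrable_norm Eint bint) auto
      finally show ?thesis by (simp add: I_def)
    qed
    have "(LINT v|lborel. k v * of_real (W v)) = (LINT v|lborel. (k v - S v) * of_real (W v) + S v * of_real (W v))"
      by (simp add: algebra_simps)
    also have "\<dots> = E + (\<Sum>n=1..N+1. a n * of_real (I (real n)))"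
      unfolding E_def by (subst Bochner_Integration.integral_add[OF Eint Sint]) (simp only: Sval)
    finally have "stable_density \<alpha> t x = of_real A * (E + (\<Sum>n=1..N+1. a n * of_real (I (real n))))"
      using stable_density_subordination[OF \<alpha> t, of x] unfolding A_def d_def k_def q_def W_def by simp
    also have "\<dots> = of_real A * E + (\<Sum>n=1..N+1. of_real A * (a n * of_real (I (real n))))"
      by (simp only: distrib_left sum_distrib_left)
    also have "(\<Sum>n=1..N+1. of_real A * (a n * of_real (I (real n)))) =
        (\<Sum>n=1..N+1. of_real (B * (asym_coeff DIM('a) \<alpha> n * r powr (- d - real n * \<alpha>))))"
    proof (rule sum.cong[OF refl])
      fix n
      have "complex_of_real (asym_coeff DIM('a) \<alpha> n) = a n * of_real (g (real n))"
        unfolding asym_coeff_rGamma a_def g_def d_def ..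
      thus "of_real A * (a n * of_real (I (real n))) = complex_of_real (B * (asym_coeff DIM('a) \<alpha> n * r powr (- d - real n * \<alpha>)))"
        unfolding Ival[OF of_nat_0_le_iff] AK[symmetric] of_real_mult by (simp only: mult_ac)
    qed
    also have "\<dots> = of_real (B * (\<Sum>n=1..N. asym_coeff DIM('a) \<alpha> n * r powr (- d - real n * \<alpha>))) +
        of_real (B * (asym_coeff DIM('a) \<alpha> (N + 1) * r powr (- d - real (N + 1) * \<alpha>)))"
      by (simp add: sum_distrib_left)
    finally have "stable_density \<alpha> t x - of_real (B * (\<Sum>n=1..N. asym_coeff DIM('a) \<alpha> n * r powr (- d - real n * \<alpha>))) =
        of_real A * E + of_real (B * (asym_coeff DIM('a) \<alpha> (N + 1) * r powr (- d - real (N + 1) * \<alpha>)))"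
      by simp
    also have "norm \<dots> \<le> A * norm E + B * (\<bar>asym_coeff DIM('a) \<alpha> (N + 1)\<bar> * r powr (- d - real (N + 1) * \<alpha>))"
      by (rule order_trans[OF norm_triangle_ineq]) (use A0 B0 in \<open>simp add: norm_mult abs_mult\<close>)
    also have "A * norm E \<le> B * (\<bar>M\<bar> * g b * r powr (- d - real (N + 1) * \<alpha>))"
    proof -
      have "A * norm E \<le> A * (\<bar>M\<bar> * I b)" by (intro mult_left_mono E A0)
      also have "\<dots> = B * (\<bar>M\<bar> * g b * r powr (- d - b * \<alpha>))"
        unfolding Ival[OF b0] AK[symmetric] by (simp only: mult_ac)
      \<comment> \<open>Here r \<ge> 1 is used: the exponent b = N + 3/2 is weakened to N +
        1.\<close>
      also have "\<dots> \<le> B * (\<bar>M\<bar> * g b * r powr (- d - real (N + 1) * \<alpha>))"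
        using r1 g B0 \<alpha> by (intro mult_left_mono powr_mono) (auto simp: b_def r_def)
      finally show ?thesis .
    qed
    finally have "norm (stable_density \<alpha> t x - of_real (B * (\<Sum>n=1..N. asym_coeff DIM('a) \<alpha> n * r powr (- d - real n * \<alpha>))))
        \<le> B * (\<bar>M\<bar> * g b * r powr (- d - real (N + 1) * \<alpha>)) + B * (\<bar>asym_coeff DIM('a) \<alpha> (N + 1)\<bar> * r powr (- d - real (N + 1) * \<alpha>))"
      by simp
    also have "\<dots> = C * t powr (- d / \<alpha>) * r powr (- d - real (N + 1) * \<alpha>)"
      by (simp add: C_def B_def field_simps)
    finally show ?thesis unfolding B_def r_def .
  qed
  thus ?thesis unfolding d_def by blast
qed

end

theorem theorem3p1:
  fixes \<alpha> :: real
  assumes dim: "DIM('a::euclidean_space) \<ge> 2"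
    and \<alpha>: "0 < \<alpha>" "\<alpha> < 2"
  shows "(\<forall>c t (x::'a). (real DIM('a) - 1) / 2 < c \<and> c < real DIM('a) \<and> 0 < t \<and> x \<noteq> 0 \<longrightarrow>
            (\<lambda>y. mb_integrand DIM('a) \<alpha> (t powr (-1/\<alpha>) * norm x) (Complex c y)) \<in> borel_measurable lborel \<and>
            integrable lborel (\<lambda>y. mb_integrand DIM('a) \<alpha> (t powr (-1/\<alpha>) * norm x) (Complex c y)) \<and>
            stable_density \<alpha> t x =
              complex_of_real (t powr (- real DIM('a) / \<alpha>) / (\<alpha> * pi powr (real DIM('a) / 2))) *
              (1 / (2 * pi * \<i>)) *
              (LINT y|lborel. mb_integrand DIM('a) \<alpha> (t powr (-1/\<alpha>) * norm x) (Complex c y) * \<i>))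
       \<and> (\<forall>N::nat. \<exists>C R. \<forall>t (x::'a). 0 < t \<and> R \<le> t powr (-1/\<alpha>) * norm x \<longrightarrow>
            norm (stable_density \<alpha> t x -
              complex_of_real (t powr (- real DIM('a) / \<alpha>) / pi powr (real DIM('a) / 2) *
                (\<Sum>n=1..N. asym_coeff DIM('a) \<alpha> n *
                   (t powr (-1/\<alpha>) * norm x) powr (- real DIM('a) - real n * \<alpha>))))
            \<le> C * t powr (- real DIM('a) / \<alpha>) *
                (t powr (-1/\<alpha>) * norm x) powr (- real DIM('a) - real (N + 1) * \<alpha>))"
proof (intro conjI allI impI)
  fix c t :: real and x :: 'a
  assume "(real DIM('a) - 1) / 2 < c \<and> c < real DIM('a) \<and> 0 < t \<and> x \<noteq> 0"
  \<comment> \<open>The lower bound (d - 1)/2 is positive because d \<ge> 2.\<close>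
  hence prems: "0 < c" "c < real DIM('a)" "0 < t" "x \<noteq> 0" using dim by auto
  note rep = mellin_barnes_representation[OF \<alpha> prems]
  show "integrable lborel (\<lambda>y. mb_integrand DIM('a) \<alpha> (t powr (-1/\<alpha>) * norm x) (Complex c y))"
    by (rule rep(1))
  thus "(\<lambda>y. mb_integrand DIM('a) \<alpha> (t powr (-1/\<alpha>) * norm x) (Complex c y)) \<in> borel_measurable lborel"
    by (rule borel_measurable_integrable)
  show "stable_density \<alpha> t x =
          complex_of_real (t powr (- real DIM('a) / \<alpha>) / (\<alpha> * pi powr (real DIM('a) / 2))) *
          (1 / (2 * pi * \<i>)) *
          (LINT y|lborel. mb_integrand DIM('a) \<alpha> (t powr (-1/\<alpha>) * norm x) (Complex c y) * \<i>)"
    by (rule rep(2))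
next
  fix N :: nat
  show "\<exists>C R. \<forall>t (x::'a). 0 < t \<and> R \<le> t powr (-1/\<alpha>) * norm x \<longrightarrow>
            norm (stable_density \<alpha> t x -
              complex_of_real (t powr (- real DIM('a) / \<alpha>) / pi powr (real DIM('a) / 2) *
                (\<Sum>n=1..N. asym_coeff DIM('a) \<alpha> n *
                   (t powr (-1/\<alpha>) * norm x) powr (- real DIM('a) - real n * \<alpha>))))
            \<le> C * t powr (- real DIM('a) / \<alpha>) *
                (t powr (-1/\<alpha>) * norm x) powr (- real DIM('a) - real (N + 1) * \<alpha>)"
    \<comment> \<open>The estimate already holds from R = 1 on.\<close>
    using stable_density_asymptotics[OF \<alpha>, where 'a = 'a, of N] by blast
qed

end
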